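(* Let $(M^5,g,\xi,\eta,\varphi)$ be a $5$-dimensional almost contact metric manifold of class $\mathcal{W}_1\oplus\mathcal{W}_2$. Then there exists a unique metric connection $\nabla^c$ with vectorial torsion compatible with the almost contact metric structure. $\nabla^c$ is given by $$g(\nabla^c_XY,Z)=g(\nabla^g_XY,Z)-\theta_1\Big(\tfrac14\,\delta\eta\cdot\eta+\xi\lrcorner d\eta\Big)(X,Y,Z).$$ Moreover, $(M^5,g,\xi,\eta,\varphi)$ is of class a) $\mathcal{W}_1$ if and only if $d\eta=0$. b) $\mathcal{W}_2$ if and only if $\delta\eta=0$.
   Context: Local model. $\mathbb{R}^5$ is Euclidean space with scalar product $\langle\cdot,\cdot\rangle$, an orientation and an oriented orthonormal basis $(e_1,\dots,e_5)$; vectors and $1$-forms are identified via $\langle\cdot,\cdot\rangle$; $\Lambda^k$ is the space of $k$-forms on $\mathbb{R}^5$, $*$ the Hodge operator, $\lrcorner$ the interior product, and $(e_1\wedge e_2)(e_1,e_2)=1$. Put $\xi=e_5$, $\eta$ its dual $1$-form, $\varphi$ the endomorphism with $\varphi(e_1)=-e_2$, $\varphi(e_2)=e_1$, $\varphi(e_3)=-e_4$, $\varphi(e_4)=e_3$, $\varphi(\xi)=0$, and $\Phi(X,Y)=\langle X,\varphi(Y)\rangle$, so $\Phi=e_1\wedge e_2+e_3\wedge e_4$. $U(2)=\{B\in O(5): B\xi=\xi,\ B\circ\varphi=\varphi\circ B\}$. $\Lambda^1_1=\mathbb{R}\eta$, $\Lambda^1_2=\{\alpha\in\Lambda^1:\xi\lrcorner\alpha=0\}$;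 $\Lambda^2_1=\mathbb{R}\Phi$, $\Lambda^2_2=\{\alpha\in\Lambda^2:\Phi\wedge\alpha=0,\ *\alpha=\eta\wedge\alpha\}$, $\Lambda^2_3=\{\alpha\in\Lambda^2:*\alpha=-\eta\wedge\alpha\}$, $\Lambda^2_4=\{\alpha\in\Lambda^2:\eta\wedge\alpha=0\}$. Identifying $\mathfrak{so}(5)=\Lambda^2$, $\mathfrak{u}(2)=\Lambda^2_1\oplus\Lambda^2_3$ has orthogonal complement $\mathfrak{m}=\Lambda^2_2\oplus\Lambda^2_4$; $\operatorname{pr}_{\mathfrak m}:\Lambda^2\to\mathfrak{m}$ is the orthogonal projection. $\mathcal{A}=\Lambda^1\otimes\Lambda^2=\{A\in\otimes^3\Lambda^1: A(X,Y,Z)+A(X,Z,Y)=0\}$, where $(\alpha\otimes\beta)(X,Y,Z)=\alpha(X)\beta(Y,Z)$; $\mathcal{W}=\Lambda^1\otimes\mathfrak{m}$ and $\operatorname{pr}_{\mathcal W}:\mathcal{A}\to\mathcal{W}$, $\operatorname{pr}_{\mathcal W}(\alpha\otimes\beta)=\alpha\otimes\operatorname{pr}_{\mathfrak m}(\beta)$. For a $1$-form $\alpha$, $\theta_1(\alpha)(X,Y,Z)=\alpha(Z)\langle X,Y\rangle-\alpha(Y)\langle X,Z\rangle$. Two of the ten $U(2)$-irreducible summands $\mathcal{W}_1,\dots,\mathcal{W}_{10}$ of $\mathcal{W}$ considered are $\mathcal{W}_1=\theta_1(\Lambda^1_1)$ and $\mathcal{W}_2=\operatorname{pr}_{\mathcal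 W}(\theta_1(\Lambda^1_2))$. Manifolds. An almost contact metric $5$-manifold $(M^5,g,\xi,\eta,\varphi)$ is a Riemannian $5$-manifold with a unit vector field $\xi$, its dual $1$-form $\eta$ and an endomorphism $\varphi$ of $TM^5$ with $\varphi(\xi)=0$, $\varphi^2=-\mathrm{Id}+\eta\otimes\xi$, $g(\varphi X,\varphi Y)=g(X,Y)-\eta(X)\eta(Y)$. Its fundamental form is $\Phi(X,Y)=g(X,\varphi(Y))$. Locally there are adapted frames: oriented orthonormal frames $(e_1,\dots,e_5)$ with $\xi=e_5$, $\Phi=e_1\wedge e_2+e_3\wedge e_4$, which identify each tangent space with the local model (all subspaces above are $U(2)$-invariant, hence define subbundles). With $\nabla^g$ the Levi-Civita connection and $\omega^g_{ij}=g(\nabla^ge_i,e_j)$, put $\Omega^g(X)=\sum_{i<j}\omega^g_{ij}(X)\,e_i\wedge e_j$. The intrinsic torsion is $\Gamma=\operatorname{pr}_{\mathfrak m}(\Omega^g)$, a section of $\mathcal{W}$. The manifold is of class $\mathcal{W}_{i_1}\oplus\dots\oplus\mathcal{W}_{i_k}$ if $\Gamma\in\mathcal{W}_{i_1}\oplus\dots\oplus\mathcal{W}_{i_k}$. For forms, $d\alpha=\sum_ie_i\wedge\nabla^g_{e_i}\alpha$, $\delta\alpha=-\sum_ie_i\lrcorner\nabla^g_{e_i}\alpha$. Connections. A metric connection $\nabla$ has torsion $T(X,Y,Z)=g(\nabla_XY-\nabla_YX-[X,Y],Z)$. $T$ is vectorial if there is a $1$-form $\alpha$ with $T(X,Y,Z)=\alpha(X)g(Y,Z)-\alpha(Y)g(X,Z)$.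 $\nabla$ is compatible with the almost contact metric structure if $\nabla\xi=0$, $\nabla\eta=0$, $\nabla\varphi=0$. *)

theory Defs
  imports "HOL-Analysis.Analysis"
begin

section \<open>The local model\<close>

text \<open>
  Forms and tensors on \<open>\<real>\<^sup>5\<close> are given by their components in the oriented orthonormal basis
  \<open>e\<^sub>i = axis i 1\<close>; in the index type \<open>5\<close> the numeral \<open>5\<close> equals \<open>0\<close>, so that
  \<open>UNIV = {1, 2, 3, 4, 5}\<close>. The metric is \<open>mat 1\<close>, and wedge products are normalised by
  \<open>(e\<^sub>1 \<and> e\<^sub>2)(e\<^sub>1, e\<^sub>2) = 1\<close>.
\<close>

type_synonym form1 = "real ^ 5"
type_synonym tensor2 = "real ^ 5 ^ 5"
type_synonym tensor3 = "real ^ 5 ^ 5 ^ 5"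
type_synonym tensor4 = "real ^ 5 ^ 5 ^ 5 ^ 5"

definition Lambda2 :: "tensor2 set" where
  "Lambda2 = {\<alpha>. \<forall>i j. \<alpha> $ i $ j = - (\<alpha> $ j $ i)}"

definition wedge11 :: "form1 \<Rightarrow> form1 \<Rightarrow> tensor2" where
  "wedge11 a b = (\<chi> i j. a $ i * b $ j - a $ j * b $ i)"

definition wedge12 :: "form1 \<Rightarrow> tensor2 \<Rightarrow> tensor3" where
  "wedge12 a \<alpha> = (\<chi> i j k. a $ i * \<alpha> $ j $ k + a $ j * \<alpha> $ k $ i + a $ k * \<alpha> $ i $ j)"

definition wedge22 :: "tensor2 \<Rightarrow> tensor2 \<Rightarrow> tensor4" where
  "wedge22 \<alpha> \<beta> = (\<chi> i j k l.
     \<alpha> $ i $ j * \<beta> $ k $ l - \<alpha> $ i $ k * \<beta> $ j $ l + \<alpha> $ i $ l * \<beta> $ j $ k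
   + \<alpha> $ j $ k * \<beta> $ i $ l - \<alpha> $ j $ l * \<beta> $ i $ k + \<alpha> $ k $ l * \<beta> $ i $ j)"

definition volume5 :: "real ^ 5 \<Rightarrow> real ^ 5 \<Rightarrow> real ^ 5 \<Rightarrow> real ^ 5 \<Rightarrow> real ^ 5 \<Rightarrow> real" where
  "volume5 v1 v2 v3 v4 v5 =
     det ((\<chi> r. if r = 1 then v1 else if r = 2 then v2 else if r = 3 then v3
                else if r = 4 then v4 else v5) :: real ^ 5 ^ 5)"

text \<open>
  Hodge operator on 2-forms: half the sum over all \<open>(i, j)\<close> is the sum over \<open>i < j\<close>, so that
  for instance \<open>* (e\<^sub>1 \<and> e\<^sub>2) = e\<^sub>3 \<and> e\<^sub>4 \<and> e\<^sub>5\<close>.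
\<close>
definition hodge2 :: "tensor2 \<Rightarrow> tensor3" where
  "hodge2 \<alpha> = (\<chi> k l m. (1/2) * (\<Sum>i\<in>UNIV. \<Sum>j\<in>UNIV.
     \<alpha> $ i $ j * volume5 (axis i 1) (axis j 1) (axis k 1) (axis l 1) (axis m 1)))"

definition eta0 :: form1 where
  "eta0 = axis 5 1"

definition Phi0 :: tensor2 where
  "Phi0 = wedge11 (axis 1 1) (axis 2 1) + wedge11 (axis 3 1) (axis 4 1)"

definition Lambda1_1 :: "form1 set" where
  "Lambda1_1 = span {eta0}"

definition Lambda1_2 :: "form1 set" where
  "Lambda1_2 = {\<alpha>. \<alpha> $ 5 = 0}"

definition Lambda2_2 :: "tensor2 set" where
  "Lambda2_2 = {\<alpha> \<in> Lambda2. wedge22 Phi0 \<alpha> = 0 \<and> hodge2 \<alpha> = wedge12 eta0 \<alpha>}"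

definition Lambda2_4 :: "tensor2 set" where
  "Lambda2_4 = {\<alpha> \<in> Lambda2. wedge12 eta0 \<alpha> = 0}"

definition mm :: "tensor2 set" where
  "mm = {\<alpha> + \<beta> | \<alpha> \<beta>. \<alpha> \<in> Lambda2_2 \<and> \<beta> \<in> Lambda2_4}"

text \<open>
  The inner product of the matrix type is twice the one in which the \<open>e\<^sub>i \<and> e\<^sub>j\<close>, \<open>i < j\<close>, are
  orthonormal, so it defines the same orthogonal projection.
\<close>
definition pr_m :: "tensor2 \<Rightarrow> tensor2" where
  "pr_m \<alpha> = (THE \<beta>. \<beta> \<in> mm \<and> (\<forall>\<gamma>\<in>mm. (\<alpha> - \<beta>) \<bullet> \<gamma> = 0))"

definition pr_W :: "tensor3 \<Rightarrow> tensor3" where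
  "pr_W A = (\<chi> i. pr_m (A $ i))"

definition theta0 :: "form1 \<Rightarrow> tensor3" where
  "theta0 a = (\<chi> i j k. a $ k * mat 1 $ i $ j - a $ j * mat 1 $ i $ k)"

definition W1 :: "tensor3 set" where
  "W1 = theta0 ` Lambda1_1"

definition W2 :: "tensor3 set" where
  "W2 = (pr_W \<circ> theta0) ` Lambda1_2"

definition W1_plus_W2 :: "tensor3 set" where
  "W1_plus_W2 = {A + B | A B. A \<in> W1 \<and> B \<in> W2}"


section \<open>Smooth 5-manifolds\<close>

primrec Ck_on :: "nat \<Rightarrow> 'a::euclidean_space set \<Rightarrow> ('a \<Rightarrow> 'b::real_normed_vector) \<Rightarrow> bool" where
  "Ck_on 0 S f \<longleftrightarrow> continuous_on S f"
| "Ck_on (Suc k) S f \<longleftrightarrow>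
     (\<forall>x\<in>S. f differentiable (at x)) \<and> (\<forall>v. Ck_on k S (\<lambda>x. frechet_derivative f (at x) v))"

text \<open>Only meant for open \<open>S\<close>.\<close>
definition Cinf_on :: "'a::euclidean_space set \<Rightarrow> ('a \<Rightarrow> 'b::real_normed_vector) \<Rightarrow> bool" where
  "Cinf_on S f \<longleftrightarrow> (\<forall>k. Ck_on k S f)"

type_synonym 'm chart = "'m set \<times> ('m \<Rightarrow> real ^ 5)"

text \<open>The manifold is the whole type \<open>'m\<close>.\<close>
definition smooth_atlas :: "'m::{t2_space, second_countable_topology} chart set \<Rightarrow> bool" where
  "smooth_atlas A \<longleftrightarrow>
     (\<Union>(U, c)\<in>A. U) = UNIV \<and>
     (\<forall>(U, c)\<in>A. open U \<and> open (c ` U) \<and> homeomorphism U (c ` U) c (inv_into U c)) \<and>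
     (\<forall>(U, c)\<in>A. \<forall>(V, d)\<in>A. Cinf_on (c ` (U \<inter> V)) (d \<circ> inv_into U c))"

definition smooth_fun_on :: "'m::topological_space chart set \<Rightarrow> 'm set \<Rightarrow> ('m \<Rightarrow> real) \<Rightarrow> bool" where
  "smooth_fun_on A U f \<longleftrightarrow>
     open U \<and> (\<forall>(V, c)\<in>A. Cinf_on (c ` (U \<inter> V)) (f \<circ> inv_into V c))"

definition smooth_near :: "'m::topological_space chart set \<Rightarrow> 'm \<Rightarrow> ('m \<Rightarrow> real) \<Rightarrow> bool" where
  "smooth_near A p f \<longleftrightarrow> (\<exists>U. p \<in> U \<and> smooth_fun_on A U f)"

text \<open>
  Tangent vectors at \<open>p\<close> are derivations of the functions that are smooth near \<open>p\<close>, set to \<open>0\<close> on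
  all other functions so that equality of tangent vectors is equality in HOL. As the indicator
  function of a neighbourhood of \<open>p\<close> is smooth near \<open>p\<close>, the Leibniz rule implies that
  a derivation depends only on germs; the same applies to connections below.
\<close>
type_synonym 'm tvec = "('m \<Rightarrow> real) \<Rightarrow> real"
type_synonym 'm vfield = "'m \<Rightarrow> 'm tvec"
type_synonym 'm oneform = "'m \<Rightarrow> 'm tvec \<Rightarrow> real"
type_synonym 'm metric = "'m \<Rightarrow> 'm tvec \<Rightarrow> 'm tvec \<Rightarrow> real"
type_synonym 'm endo = "'m \<Rightarrow> 'm tvec \<Rightarrow> 'm tvec"

definition lincomb :: "real \<Rightarrow> 'm tvec \<Rightarrow> real \<Rightarrow> 'm tvec \<Rightarrow> 'm tvec" where
  "lincomb a v b w = (\<lambda>f. a * v f + b * w f)"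

definition tangent :: "'m::topological_space chart set \<Rightarrow> 'm \<Rightarrow> 'm tvec set" where
  "tangent A p = {v.
     (\<forall>f. \<not> smooth_near A p f \<longrightarrow> v f = 0) \<and>
     (\<forall>f h a b. smooth_near A p f \<longrightarrow> smooth_near A p h \<longrightarrow>
        v (\<lambda>q. a * f q + b * h q) = a * v f + b * v h) \<and>
     (\<forall>f h. smooth_near A p f \<longrightarrow> smooth_near A p h \<longrightarrow>
        v (\<lambda>q. f q * h q) = f p * v h + h p * v f)}"

definition vfield_on :: "'m::topological_space chart set \<Rightarrow> 'm set \<Rightarrow> 'm vfield \<Rightarrow> bool" where
  "vfield_on A U X \<longleftrightarrow>
     open U \<and> (\<forall>q\<in>U. X q \<in> tangent A q) \<and>
     (\<forall>V f. V \<subseteq> U \<longrightarrow> smooth_fun_on A V f \<longrightarrow> smooth_fun_on A V (\<lambda>q. X q f))"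

definition vfield_near :: "'m::topological_space chart set \<Rightarrow> 'm \<Rightarrow> 'm vfield \<Rightarrow> bool" where
  "vfield_near A p X \<longleftrightarrow> (\<exists>U. p \<in> U \<and> vfield_on A U X)"

definition bracket :: "'m::topological_space chart set \<Rightarrow> 'm vfield \<Rightarrow> 'm vfield \<Rightarrow> 'm vfield" where
  "bracket A X Y p = (\<lambda>f. if smooth_near A p f
     then X p (\<lambda>q. Y q f) - Y p (\<lambda>q. X q f) else 0)"

definition smooth_oneform :: "'m::topological_space chart set \<Rightarrow> 'm oneform \<Rightarrow> bool" where
  "smooth_oneform A \<alpha> \<longleftrightarrow>
     (\<forall>p. \<forall>v\<in>tangent A p. \<forall>w\<in>tangent A p. \<forall>a b.
        \<alpha> p (lincomb a v b w) = a * \<alpha> p v + b * \<alpha> p w) \<and>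
     (\<forall>U X. vfield_on A U X \<longrightarrow> smooth_fun_on A U (\<lambda>q. \<alpha> q (X q)))"

definition smooth_endo :: "'m::topological_space chart set \<Rightarrow> 'm endo \<Rightarrow> bool" where
  "smooth_endo A \<phi> \<longleftrightarrow>
     (\<forall>p. \<forall>v\<in>tangent A p. \<phi> p v \<in> tangent A p) \<and>
     (\<forall>p. \<forall>v\<in>tangent A p. \<forall>w\<in>tangent A p. \<forall>a b.
        \<phi> p (lincomb a v b w) = lincomb a (\<phi> p v) b (\<phi> p w)) \<and>
     (\<forall>U X. vfield_on A U X \<longrightarrow> vfield_on A U (\<lambda>q. \<phi> q (X q)))"

definition riemannian_metric :: "'m::topological_space chart set \<Rightarrow> 'm metric \<Rightarrow> bool" where
  "riemannian_metric A g \<longleftrightarrow>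
     (\<forall>p. \<forall>v\<in>tangent A p. \<forall>w\<in>tangent A p. g p v w = g p w v) \<and>
     (\<forall>p. \<forall>u\<in>tangent A p. \<forall>v\<in>tangent A p. \<forall>w\<in>tangent A p. \<forall>a b.
        g p (lincomb a u b v) w = a * g p u w + b * g p v w) \<and>
     (\<forall>p. \<forall>v\<in>tangent A p. v \<noteq> (\<lambda>_. 0) \<longrightarrow> g p v v > 0) \<and>
     (\<forall>U X Y. vfield_on A U X \<longrightarrow> vfield_on A U Y \<longrightarrow>
        smooth_fun_on A U (\<lambda>q. g q (X q) (Y q)))"


section \<open>Connections\<close>

text \<open>
  \<open>D p v Y\<close> is \<open>\<nabla>\<^sub>v Y\<close> for \<open>v \<in> T\<^sub>p M\<close> and a vector field \<open>Y\<close> defined near \<open>p\<close>, hence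
  \<open>(\<nabla>\<^sub>X Y)(p) = D p (X p) Y\<close>. Other arguments are mapped to \<open>0\<close>, which makes it possible to
  express uniqueness of connections by equality in HOL.
\<close>
type_synonym 'm conn = "'m \<Rightarrow> 'm tvec \<Rightarrow> 'm vfield \<Rightarrow> 'm tvec"

definition connection :: "'m::topological_space chart set \<Rightarrow> 'm conn \<Rightarrow> bool" where
  "connection A D \<longleftrightarrow>
     (\<forall>p v Y. v \<in> tangent A p \<and> vfield_near A p Y \<longrightarrow> D p v Y \<in> tangent A p) \<and>
     (\<forall>p v Y. \<not> (v \<in> tangent A p \<and> vfield_near A p Y) \<longrightarrow> D p v Y = (\<lambda>_. 0)) \<and>
     (\<forall>p Y. vfield_near A p Y \<longrightarrow> (\<forall>v\<in>tangent A p. \<forall>w\<in>tangent A p. \<forall>a b.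
        D p (lincomb a v b w) Y = lincomb a (D p v Y) b (D p w Y))) \<and>
     (\<forall>p Y Z. vfield_near A p Y \<longrightarrow> vfield_near A p Z \<longrightarrow> (\<forall>v\<in>tangent A p.
        D p v (\<lambda>q. lincomb 1 (Y q) 1 (Z q)) = lincomb 1 (D p v Y) 1 (D p v Z))) \<and>
     (\<forall>p f Y. smooth_near A p f \<longrightarrow> vfield_near A p Y \<longrightarrow> (\<forall>v\<in>tangent A p.
        D p v (\<lambda>q h. f q * Y q h) = lincomb (f p) (D p v Y) (v f) (Y p))) \<and>
     (\<forall>U X Y. vfield_on A U X \<longrightarrow> vfield_on A U Y \<longrightarrow> vfield_on A U (\<lambda>q. D q (X q) Y))"

definition metric_connection :: "'m::topological_space chart set \<Rightarrow> 'm metric \<Rightarrow> 'm conn \<Rightarrow> bool" where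
  "metric_connection A g D \<longleftrightarrow> connection A D \<and>
     (\<forall>p Y Z. vfield_near A p Y \<longrightarrow> vfield_near A p Z \<longrightarrow> (\<forall>v\<in>tangent A p.
        v (\<lambda>q. g q (Y q) (Z q)) = g p (D p v Y) (Z p) + g p (Y p) (D p v Z)))"

definition torsion :: "'m::topological_space chart set \<Rightarrow> 'm conn \<Rightarrow> 'm vfield \<Rightarrow> 'm vfield \<Rightarrow> 'm vfield" where
  "torsion A D X Y p = (\<lambda>f. D p (X p) Y f - D p (Y p) X f - bracket A X Y p f)"

definition levi_civita :: "'m::topological_space chart set \<Rightarrow> 'm metric \<Rightarrow> 'm conn \<Rightarrow> bool" where
  "levi_civita A g D \<longleftrightarrow> metric_connection A g D \<and>
     (\<forall>p X Y. vfield_near A p X \<longrightarrow> vfield_near A p Y \<longrightarrow> torsion A D X Y p = (\<lambda>_. 0))"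

definition vectorial_torsion :: "'m::topological_space chart set \<Rightarrow> 'm metric \<Rightarrow> 'm conn \<Rightarrow> bool" where
  "vectorial_torsion A g D \<longleftrightarrow> (\<exists>\<alpha>. smooth_oneform A \<alpha> \<and>
     (\<forall>p X Y. vfield_near A p X \<longrightarrow> vfield_near A p Y \<longrightarrow> (\<forall>z\<in>tangent A p.
        g p (torsion A D X Y p) z = \<alpha> p (X p) * g p (Y p) z - \<alpha> p (Y p) * g p (X p) z)))"

text \<open>
  \<open>(\<nabla>\<^sub>v \<alpha>)(w) = v (\<alpha>(W)) - \<alpha>(\<nabla>\<^sub>v W)\<close> for an arbitrary local vector field \<open>W\<close> extending \<open>w\<close>.
\<close>
definition nabla_oneform ::
    "'m::topological_space chart set \<Rightarrow> 'm conn \<Rightarrow> 'm oneform \<Rightarrow> 'm \<Rightarrow> 'm tvec \<Rightarrow> 'm tvec \<Rightarrow> real" where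
  "nabla_oneform A D \<alpha> p v w = (let W = (SOME W. vfield_near A p W \<and> W p = w)
     in v (\<lambda>q. \<alpha> q (W q)) - \<alpha> p (D p v W))"

definition orthonormal_basis ::
    "'m::topological_space chart set \<Rightarrow> 'm metric \<Rightarrow> 'm \<Rightarrow> (5 \<Rightarrow> 'm tvec) \<Rightarrow> bool" where
  "orthonormal_basis A g p b \<longleftrightarrow>
     (\<forall>i. b i \<in> tangent A p) \<and>
     (\<forall>i j. g p (b i) (b j) = (if i = j then 1 else 0)) \<and>
     (\<forall>v\<in>tangent A p. \<exists>c. v = (\<lambda>f. \<Sum>i\<in>UNIV. c i * b i f))"

text \<open>
  \<open>d\<alpha> = \<Sum>\<^sub>i e\<^sub>i \<and> \<nabla>\<^sub>e\<^sub>i \<alpha>\<close> and \<open>\<delta>\<alpha> = - \<Sum>\<^sub>i e\<^sub>i \<lrcorner> \<nabla>\<^sub>e\<^sub>i \<alpha>\<close> for 1-forms \<open>\<alpha>\<close>; to be used with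
  the Levi-Civita connection. The values do not depend on the choice of the orthonormal basis.
\<close>
definition ext_deriv :: "'m::topological_space chart set \<Rightarrow> 'm metric \<Rightarrow> 'm conn \<Rightarrow> 'm oneform
    \<Rightarrow> 'm \<Rightarrow> 'm tvec \<Rightarrow> 'm tvec \<Rightarrow> real" where
  "ext_deriv A g D \<alpha> p v w = (let e = (SOME b. orthonormal_basis A g p b) in
     \<Sum>i\<in>UNIV. g p (e i) v * nabla_oneform A D \<alpha> p (e i) w
             - g p (e i) w * nabla_oneform A D \<alpha> p (e i) v)"

definition codiff :: "'m::topological_space chart set \<Rightarrow> 'm metric \<Rightarrow> 'm conn \<Rightarrow> 'm oneform
    \<Rightarrow> 'm \<Rightarrow> real" where
  "codiff A g D \<alpha> p = (let e = (SOME b. orthonormal_basis A g p b) in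
     - (\<Sum>i\<in>UNIV. nabla_oneform A D \<alpha> p (e i) (e i)))"

definition theta1 :: "'m metric \<Rightarrow> 'm oneform \<Rightarrow> 'm \<Rightarrow> 'm tvec \<Rightarrow> 'm tvec \<Rightarrow> 'm tvec \<Rightarrow> real" where
  "theta1 g \<alpha> p x y z = \<alpha> p z * g p x y - \<alpha> p y * g p x z"


section \<open>Almost contact metric structures\<close>

definition almost_contact_metric :: "'m::{t2_space, second_countable_topology} chart set \<Rightarrow>
    'm metric \<Rightarrow> 'm vfield \<Rightarrow> 'm oneform \<Rightarrow> 'm endo \<Rightarrow> bool" where
  "almost_contact_metric A g \<xi> \<eta> \<phi> \<longleftrightarrow>
     smooth_atlas A \<and> riemannian_metric A g \<and>
     vfield_on A UNIV \<xi> \<and> (\<forall>p. g p (\<xi> p) (\<xi> p) = 1) \<and>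
     smooth_oneform A \<eta> \<and> (\<forall>p. \<forall>v\<in>tangent A p. \<eta> p v = g p (\<xi> p) v) \<and>
     smooth_endo A \<phi> \<and> (\<forall>p. \<phi> p (\<xi> p) = (\<lambda>_. 0)) \<and>
     (\<forall>p. \<forall>v\<in>tangent A p. \<phi> p (\<phi> p v) = lincomb (- 1) v (\<eta> p v) (\<xi> p)) \<and>
     (\<forall>p. \<forall>v\<in>tangent A p. \<forall>w\<in>tangent A p.
        g p (\<phi> p v) (\<phi> p w) = g p v w - \<eta> p v * \<eta> p w)"

definition compatible :: "'m::topological_space chart set \<Rightarrow> 'm vfield \<Rightarrow> 'm oneform \<Rightarrow> 'm endo
    \<Rightarrow> 'm conn \<Rightarrow> bool" where
  "compatible A \<xi> \<eta> \<phi> D \<longleftrightarrow> (\<forall>p. \<forall>v\<in>tangent A p.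
     D p v \<xi> = (\<lambda>_. 0) \<and>
     (\<forall>w\<in>tangent A p. nabla_oneform A D \<eta> p v w = 0) \<and>
     (\<forall>Y. vfield_near A p Y \<longrightarrow> D p v (\<lambda>q. \<phi> q (Y q)) = \<phi> p (D p v Y)))"

text \<open>
  No orientation is recorded: \<open>\<xi> = e\<^sub>5\<close> and \<open>\<Phi> = e\<^sub>1 \<and> e\<^sub>2 + e\<^sub>3 \<and> e\<^sub>4\<close> determine
  \<open>e\<^sub>1 \<and> \<dots> \<and> e\<^sub>5 = (1/2) \<Phi> \<and> \<Phi> \<and> \<eta>\<close>, the orientation induced by the structure.
\<close>
definition adapted_frame_on :: "'m::topological_space chart set \<Rightarrow> 'm metric \<Rightarrow> 'm vfield \<Rightarrow>
    'm endo \<Rightarrow> 'm set \<Rightarrow> (5 \<Rightarrow> 'm vfield) \<Rightarrow> bool" where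
  "adapted_frame_on A g \<xi> \<phi> U e \<longleftrightarrow>
     (\<forall>i. vfield_on A U (e i)) \<and>
     (\<forall>q\<in>U. orthonormal_basis A g q (\<lambda>i. e i q)) \<and>
     (\<forall>q\<in>U. e 5 q = \<xi> q) \<and>
     (\<forall>q\<in>U. \<forall>i j. g q (e i q) (\<phi> q (e j q)) = Phi0 $ i $ j)"

text \<open>
  Components of \<open>\<Gamma> = pr\<^sub>m(\<Omega>\<^sup>g)\<close> in the frame \<open>e\<close>. As \<open>\<omega>\<^sub>j\<^sub>k = - \<omega>\<^sub>k\<^sub>j\<close>, the 2-form
  \<open>\<Omega>\<^sup>g(e\<^sub>i) = \<Sum>\<^sub>j\<^sub><\<^sub>k \<omega>\<^sub>j\<^sub>k(e\<^sub>i) e\<^sub>j \<and> e\<^sub>k\<close> has components \<open>\<omega>\<^sub>j\<^sub>k(e\<^sub>i)\<close>.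
\<close>
definition intrinsic_torsion :: "'m metric \<Rightarrow> 'm conn \<Rightarrow> (5 \<Rightarrow> 'm vfield) \<Rightarrow> 'm \<Rightarrow> tensor3" where
  "intrinsic_torsion g D e p = pr_W (\<chi> i j k. g p (D p (e i p) (e j)) (e k p))"

text \<open>
  \<open>\<Gamma>\<close> is a section of the subbundle determined by the \<open>U(2)\<close>-invariant subspace \<open>W\<close> (\<open>D\<close> is the
  Levi-Civita connection). Adapted frames exist near every point, and by invariance
  the condition does not depend on which of them is used.
\<close>
definition of_class :: "'m::topological_space chart set \<Rightarrow> 'm metric \<Rightarrow> 'm vfield \<Rightarrow> 'm endo \<Rightarrow>
    'm conn \<Rightarrow> tensor3 set \<Rightarrow> bool" where
  "of_class A g \<xi> \<phi> D W \<longleftrightarrow>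
     (\<forall>p. \<exists>U e. p \<in> U \<and> adapted_frame_on A g \<xi> \<phi> U e \<and> intrinsic_torsion g D e p \<in> W)"

end

theory Submission
  imports Defs
begin

text \<open>
  As \<open>pr\<^sub>W\<close> has kernel \<open>\<Lambda>\<^sup>1 \<otimes> u(2)\<close> and fixes \<open>W\<^sub>1\<close>, \<open>\<Gamma>\<close> lies in \<open>W\<^sub>1 \<oplus> W\<^sub>2\<close> iff at every point
  \<open>\<Omega>\<^sup>g - \<theta>\<^sub>1(\<alpha>)\<close> takes values in \<open>u(2)\<close> for some 1-form \<open>\<alpha>\<close>, that is, iff
  \<open>\<nabla>\<^sup>g - \<theta>\<^sub>1(\<alpha>)\<close> preserves the structure. Comparing the \<open>\<xi>\<close>-components gives
  \<open>g(\<nabla>\<^sup>g\<^sub>X \<xi>, Z) = \<alpha>(Z) \<eta>(X) - \<alpha>(\<xi>) g(X, Z)\<close>, whose trace and skew part are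
  \<open>\<delta>\<eta> = 4 \<alpha>(\<xi>)\<close> and \<open>d\<eta> = \<eta> \<and> \<alpha>\<close>. Hence \<open>\<alpha> = (1/4) \<delta>\<eta> \<eta> + \<xi> \<lrcorner> d\<eta>\<close>, it is smooth, and it is
  a multiple of \<open>\<eta>\<close> iff \<open>d\<eta> = 0\<close> and orthogonal to \<open>\<eta>\<close> iff \<open>\<delta>\<eta> = 0\<close>. Conversely, a metric connection
  with vectorial torsion has the form \<open>\<nabla>\<^sup>g - \<theta>\<^sub>1(\<alpha>)\<close>, and \<open>\<nabla>\<xi> = 0\<close> is the displayed equation
  for \<open>\<alpha>\<close>.
\<close>

section \<open>The projection onto \<open>m\<close> in coordinates\<close>

lemma exhaust_5: fixes x :: 5 shows "x = 1 \<or> x = 2 \<or> x = 3 \<or> x = 4 \<or> x = 5"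
proof (induct x)
  case (of_int z)
  \<comment> \<open>\<open>z\<close> runs through the representatives 0 to 4, and the representative
    0 is the index written \<open>5\<close>.\<close>
  then have "z = 0 \<or> z = 1 \<or> z = 2 \<or> z = 3 \<or> z = 4" by fastforce
  then show ?case by auto
qed

lemma forall_5: "(\<forall>i::5. P i) \<longleftrightarrow> P 1 \<and> P 2 \<and> P 3 \<and> P 4 \<and> P 5"
  by (metis exhaust_5)

lemma UNIV_5: "UNIV = {1, 2, 3, 4, 5::5}"
  using exhaust_5 by auto

lemma sum_5: "sum f (UNIV::5 set) = f 1 + f 2 + f 3 + f 4 + f 5"
  unfolding UNIV_5 by (simp add: ac_simps)

section \<open>Sign rules for the volume form and components of the Hodge operator\<close>

lemma det_swap_rows:
  fixes M :: "real^'n^'n"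
  assumes "i \<noteq> j"
  shows "det (\<chi> r. M $ Transposition.transpose i j r) = - det M"
  using det_permute_rows[of "Transposition.transpose i j" M] assms
  by (simp add: permutes_swap_id sign_swap_id)

text \<open>Adjacent row exchanges are enough to sort any five basis vectors, so every value of
  \<open>volume5\<close> needed for the Hodge operator reduces to a repeated argument or to
  \<open>volume5_axis\<close>, without expanding a determinant.\<close>

lemma volume5_swap:
  "volume5 b a c d e = - volume5 a b c d e"
  "volume5 a c b d e = - volume5 a b c d e"
  "volume5 a b d c e = - volume5 a b c d e"
  "volume5 a b c e d = - volume5 a b c d e"
proof -
  let ?M = "(\<chi> r. if r = 1 then a else if r = 2 then b else if r = 3 then c
                else if r = 4 then d else e) :: real ^ 5 ^ 5"
  have "volume5 b a c d e = det (\<chi> r. ?M $ Transposition.transpose 1 2 r)"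
    "volume5 a c b d e = det (\<chi> r. ?M $ Transposition.transpose 2 3 r)"
    "volume5 a b d c e = det (\<chi> r. ?M $ Transposition.transpose 3 4 r)"
    "volume5 a b c e d = det (\<chi> r. ?M $ Transposition.transpose 4 5 r)"
    unfolding volume5_def by (rule arg_cong[of _ _ det]; simp add: vec_eq_iff forall_5 Transposition.transpose_def)+
  note * = this
  have sw: "det (\<chi> r. ?M $ Transposition.transpose i j r) = - volume5 a b c d e" if "i \<noteq> j" for i j
    using det_swap_rows[OF that, of ?M] by (simp only: volume5_def)
  show
    "volume5 b a c d e = - volume5 a b c d e"
    "volume5 a c b d e = - volume5 a b c d e"
    "volume5 a b d c e = - volume5 a b c d e"
    "volume5 a b c e d = - volume5 a b c d e"
    unfolding * by (rule sw, simp)+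
qed

lemma volume5_eq:
  "volume5 a a c d e = 0"
  "volume5 a c c d e = 0"
  "volume5 a b d d e = 0"
  "volume5 a b c e e = 0"
  using volume5_swap[of a a c d e] volume5_swap[of a c c d e]
    volume5_swap[of a b d d e] volume5_swap[of a b c e e]
  by auto

lemma volume5_axis: "volume5 (axis 1 1) (axis 2 1) (axis 3 1) (axis 4 1) (axis 5 1) = 1"
proof -
  have "(\<chi> r. if r = 1 then axis 1 1 else if r = 2 then axis 2 1 else if r = 3 then axis 3 1
                else if r = 4 then axis 4 1 else axis 5 1) = (mat 1 :: real^5^5)"
    by (simp add: vec_eq_iff forall_5 mat_def axis_def)
  then show ?thesis by (simp add: volume5_def)
qed

text \<open>Restricted to decreasing indices, so that the simplifier sorts the arguments.\<close>
lemma volume5_sort: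
  assumes "(i::5, j::5) \<in> {(2,1),(3,1),(4,1),(5,1),(3,2),(4,2),(5,2),(4,3),(5,3),(5,4)}"
  shows
    "volume5 (axis i 1) (axis j 1) c d e = - volume5 (axis j 1) (axis i 1) c d e"
    "volume5 a (axis i 1) (axis j 1) d e = - volume5 a (axis j 1) (axis i 1) d e"
    "volume5 a b (axis i 1) (axis j 1) e = - volume5 a b (axis j 1) (axis i 1) e"
    "volume5 a b c (axis i 1) (axis j 1) = - volume5 a b c (axis j 1) (axis i 1)"
  by (rule volume5_swap)+

lemmas volume5_simps = volume5_eq volume5_axis
  volume5_sort[of 2 1, simplified] volume5_sort[of 3 1, simplified]
  volume5_sort[of 4 1, simplified] volume5_sort[of 5 1, simplified]
  volume5_sort[of 3 2, simplified] volume5_sort[of 4 2, simplified]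
  volume5_sort[of 5 2, simplified] volume5_sort[of 4 3, simplified]
  volume5_sort[of 5 3, simplified] volume5_sort[of 5 4, simplified]

text \<open>Written out so that, as rewrite rules, the equations express everything through the ten
  entries above the diagonal.\<close>

lemma Lambda2_iff: "\<beta> \<in> Lambda2 \<longleftrightarrow>
  (\<beta>$1$1 = 0 \<and> \<beta>$2$2 = 0 \<and> \<beta>$3$3 = 0 \<and> \<beta>$4$4 = 0 \<and> \<beta>$5$5 = 0) \<and>
  \<beta>$2$1 = - (\<beta>$1$2) \<and> \<beta>$3$1 = - (\<beta>$1$3) \<and> \<beta>$4$1 = - (\<beta>$1$4) \<and> \<beta>$5$1 = - (\<beta>$1$5) \<and>
  \<beta>$3$2 = - (\<beta>$2$3) \<and> \<beta>$4$2 = - (\<beta>$2$4) \<and> \<beta>$5$2 = - (\<beta>$2$5) \<and>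
  \<beta>$4$3 = - (\<beta>$3$4) \<and> \<beta>$5$3 = - (\<beta>$3$5) \<and> \<beta>$5$4 = - (\<beta>$4$5)"
  unfolding Lambda2_def mem_Collect_eq forall_5 by auto

lemma Lambda2_4_iff: "\<beta> \<in> Lambda2_4 \<longleftrightarrow> \<beta> \<in> Lambda2 \<and>
  \<beta>$1$2 = 0 \<and> \<beta>$1$3 = 0 \<and> \<beta>$1$4 = 0 \<and> \<beta>$2$3 = 0 \<and> \<beta>$2$4 = 0 \<and> \<beta>$3$4 = 0"
  by (auto simp: Lambda2_4_def Lambda2_iff vec_eq_iff forall_5 wedge12_def eta0_def axis_def)

lemma eta0_nth: "eta0 $ i = (if i = 5 then 1 else 0)"
  by (simp add: eta0_def axis_def)

text \<open>Increasing index triples suffice because of \<open>alternating3_hodge2\<close>. The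
  halved differences appear because \<open>\<beta>\<close> is not assumed antisymmetric
  here.\<close>

lemma hodge2_nth:
  "hodge2 \<beta> $ 1 $ 2 $ 3 = (\<beta> $ 4 $ 5 - \<beta> $ 5 $ 4) / 2"
  "hodge2 \<beta> $ 1 $ 2 $ 4 = (\<beta> $ 5 $ 3 - \<beta> $ 3 $ 5) / 2"
  "hodge2 \<beta> $ 1 $ 2 $ 5 = (\<beta> $ 3 $ 4 - \<beta> $ 4 $ 3) / 2"
  "hodge2 \<beta> $ 1 $ 3 $ 4 = (\<beta> $ 2 $ 5 - \<beta> $ 5 $ 2) / 2"
  "hodge2 \<beta> $ 1 $ 3 $ 5 = (\<beta> $ 4 $ 2 - \<beta> $ 2 $ 4) / 2"
  "hodge2 \<beta> $ 1 $ 4 $ 5 = (\<beta> $ 2 $ 3 - \<beta> $ 3 $ 2) / 2"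
  "hodge2 \<beta> $ 2 $ 3 $ 4 = (\<beta> $ 5 $ 1 - \<beta> $ 1 $ 5) / 2"
  "hodge2 \<beta> $ 2 $ 3 $ 5 = (\<beta> $ 1 $ 4 - \<beta> $ 4 $ 1) / 2"
  "hodge2 \<beta> $ 2 $ 4 $ 5 = (\<beta> $ 3 $ 1 - \<beta> $ 1 $ 3) / 2"
  "hodge2 \<beta> $ 3 $ 4 $ 5 = (\<beta> $ 1 $ 2 - \<beta> $ 2 $ 1) / 2"
  by (simp_all add: hodge2_def sum_5 volume5_simps)

text \<open>The two adjacent transpositions generate all permutations of the three slots.\<close>

definition alternating3 :: "tensor3 \<Rightarrow> bool" where
  "alternating3 t \<longleftrightarrow> (\<forall>i j k. t $ j $ i $ k = - (t $ i $ j $ k) \<and> t $ i $ k $ j = - (t $ i $ j $ k))"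

lemma alternating3_hodge2: "alternating3 (hodge2 \<beta>)"
proof -
  have "hodge2 \<beta> $ j $ i $ k = - (hodge2 \<beta> $ i $ j $ k)" for i j k
    unfolding hodge2_def by (simp add: volume5_swap(3)[of _ _ "axis i 1" "axis j 1"] sum_negf)
  moreover have "hodge2 \<beta> $ i $ k $ j = - (hodge2 \<beta> $ i $ j $ k)" for i j k
    unfolding hodge2_def by (simp add: volume5_swap(4)[of _ _ _ "axis j 1" "axis k 1"] sum_negf)
  ultimately show ?thesis unfolding alternating3_def by (intro allI conjI)
qed

lemma alternating3_wedge12:
  assumes "\<beta> \<in> Lambda2"
  shows "alternating3 (wedge12 a \<beta>)"
proof -
  have b: "\<beta> $ i $ j = - (\<beta> $ j $ i)" for i j
    using assms unfolding Lambda2_def by blast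
  have "wedge12 a \<beta> $ j $ i $ k = - (wedge12 a \<beta> $ i $ j $ k)"
    "wedge12 a \<beta> $ i $ k $ j = - (wedge12 a \<beta> $ i $ j $ k)" for i j k
    by (simp_all add: wedge12_def b[of k j] b[of i k] b[of j i])
  then show ?thesis unfolding alternating3_def by (intro allI conjI)
qed

text \<open>The first slot \<open>h\<close> is frozen, so that identities between 4-forms can also
  be checked by \<open>alternating3_eqI\<close>.\<close>

lemma alternating3_wedge22:
  assumes "\<alpha> \<in> Lambda2" "\<beta> \<in> Lambda2"
  shows "alternating3 (wedge22 \<alpha> \<beta> $ h)"
proof -
  have b: "\<alpha> $ i $ j = - (\<alpha> $ j $ i)" "\<beta> $ i $ j = - (\<beta> $ j $ i)" for i j
    using assms unfolding Lambda2_def by blast+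
  have "wedge22 \<alpha> \<beta> $ h $ j $ i $ k = - (wedge22 \<alpha> \<beta> $ h $ i $ j $ k)"
    "wedge22 \<alpha> \<beta> $ h $ i $ k $ j = - (wedge22 \<alpha> \<beta> $ h $ i $ j $ k)" for i j k
    by (simp_all add: wedge22_def b[of k j] b[of i k] b[of j i])
  then show ?thesis unfolding alternating3_def by (intro allI conjI)
qed

text \<open>Sorting the indices by adjacent swaps reduces 125 components to ten. The swaps are
  instantiated at decreasing pairs only, which keeps the simplifier from looping.\<close>

lemma alternating3_eqI:
  assumes "alternating3 s" "alternating3 t"
    and "\<forall>(i, j, k) \<in> {(1,2,3),(1,2,4),(1,2,5),(1,3,4),(1,3,5),(1,4,5),(2,3,4),(2,3,5),(2,4,5),(3,4,5)}.
      s $ i $ j $ k = t $ i $ j $ k"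
  shows "s = t"
proof -
  have sw: "r $ j $ i $ k = - (r $ i $ j $ k)" "r $ i $ k $ j = - (r $ i $ j $ k)"
    if "alternating3 r" for r i j k
    using that[unfolded alternating3_def, rule_format, THEN conjunct1]
      that[unfolded alternating3_def, rule_format, THEN conjunct2] .
  have eq: "r $ i $ i $ k = 0" "r $ i $ k $ k = 0" if "alternating3 r" for r i k
    using sw(1)[OF that, of i i k] sw(2)[OF that, of i k k] by simp_all
  note [simp] = assms(1,2)
  show ?thesis unfolding vec_eq_iff forall_5
    by (simp add: assms(3)[simplified] eq sw(1)[of _ 2 1] sw(1)[of _ 3 1] sw(1)[of _ 4 1] sw(1)[of _ 5 1]
        sw(1)[of _ 3 2] sw(1)[of _ 4 2] sw(1)[of _ 5 2] sw(1)[of _ 4 3] sw(1)[of _ 5 3] sw(1)[of _ 5 4]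
        sw(2)[of _ _ 2 1] sw(2)[of _ _ 3 1] sw(2)[of _ _ 4 1] sw(2)[of _ _ 5 1]
        sw(2)[of _ _ 3 2] sw(2)[of _ _ 4 2] sw(2)[of _ _ 5 2] sw(2)[of _ _ 4 3] sw(2)[of _ _ 5 3] sw(2)[of _ _ 5 4])
qed

lemma Phi0_nth:
  "Phi0 $ 1 $ 1 = 0" "Phi0 $ 1 $ 2 = 1" "Phi0 $ 1 $ 3 = 0" "Phi0 $ 1 $ 4 = 0" "Phi0 $ 1 $ 5 = 0"
  "Phi0 $ 2 $ 1 = - 1" "Phi0 $ 2 $ 2 = 0" "Phi0 $ 2 $ 3 = 0" "Phi0 $ 2 $ 4 = 0" "Phi0 $ 2 $ 5 = 0"
  "Phi0 $ 3 $ 1 = 0" "Phi0 $ 3 $ 2 = 0" "Phi0 $ 3 $ 3 = 0" "Phi0 $ 3 $ 4 = 1" "Phi0 $ 3 $ 5 = 0"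
  "Phi0 $ 4 $ 1 = 0" "Phi0 $ 4 $ 2 = 0" "Phi0 $ 4 $ 3 = - 1" "Phi0 $ 4 $ 4 = 0" "Phi0 $ 4 $ 5 = 0"
  "Phi0 $ 5 $ 1 = 0" "Phi0 $ 5 $ 2 = 0" "Phi0 $ 5 $ 3 = 0" "Phi0 $ 5 $ 4 = 0" "Phi0 $ 5 $ 5 = 0"
  by (simp_all add: Phi0_def wedge11_def axis_def)

text \<open>The Hodge equation at triples without the index 5 kills the entries involving 5. At
  triples with it, it pairs the remaining entries, in particular entry 12 with entry 34. The wedge
  condition makes these two opposite as well, so both vanish.\<close>

lemma Lambda2_2_iff: "\<beta> \<in> Lambda2_2 \<longleftrightarrow> \<beta> \<in> Lambda2 \<and> \<beta>$1$2 = 0 \<and> \<beta>$3$4 = 0 \<and>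
  \<beta>$2$4 = - (\<beta>$1$3) \<and> \<beta>$2$3 = \<beta>$1$4 \<and> \<beta>$1$5 = 0 \<and> \<beta>$2$5 = 0 \<and> \<beta>$3$5 = 0 \<and> \<beta>$4$5 = 0" (is "_ = ?R")
proof
  assume b: "\<beta> \<in> Lambda2_2"
  then have l: "\<beta> \<in> Lambda2" by (simp add: Lambda2_2_def)
  from b have "wedge22 Phi0 \<beta> $ 1 $ 2 $ 3 $ 4 = 0" by (simp add: Lambda2_2_def)
  then have w: "\<beta>$1$2 + \<beta>$3$4 = 0"
    using l by (simp add: wedge22_def Phi0_nth)
  from b have h: "hodge2 \<beta> = wedge12 eta0 \<beta>" by (simp add: Lambda2_2_def)
  have *: "hodge2 \<beta> $ i $ j $ k = wedge12 eta0 \<beta> $ i $ j $ k" for i j k by (simp add: h)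
  note [simp] = hodge2_nth wedge12_def eta0_nth
  note e = *[of 1 2 3, simplified] *[of 1 2 4, simplified] *[of 1 3 4, simplified]
    *[of 2 3 4, simplified] *[of 1 2 5, simplified] *[of 1 3 5, simplified] *[of 1 4 5, simplified]
  show ?R using l w e l[unfolded Lambda2_iff] by (intro conjI) argo+
next
  assume r: ?R
  then have L: "\<beta> \<in> Lambda2" by blast
  note [simp] = r[unfolded Lambda2_iff]
  have "hodge2 \<beta> = wedge12 eta0 \<beta>"
  proof (rule alternating3_eqI[OF alternating3_hodge2 alternating3_wedge12[OF L]])
  qed (simp add: hodge2_nth wedge12_def eta0_nth)
  moreover have "wedge22 Phi0 \<beta> $ i = 0" for i
  proof (rule alternating3_eqI)
    have "Phi0 \<in> Lambda2" by (simp add: Phi0_def wedge11_def Lambda2_def)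
    then show "alternating3 (wedge22 Phi0 \<beta> $ i)" using L by (rule alternating3_wedge22)
    show "alternating3 0" by (simp add: alternating3_def)
    show "\<forall>(j, k, l) \<in> {(1,2,3),(1,2,4),(1,2,5),(1,3,4),(1,3,5),(1,4,5),(2,3,4),(2,3,5),(2,4,5),(3,4,5)}.
      wedge22 Phi0 \<beta> $ i $ j $ k $ l = 0 $ j $ k $ l"
      using exhaust_5[of i] by (elim disjE; simp add: wedge22_def Phi0_nth)
  qed
  ultimately show "\<beta> \<in> Lambda2_2" using L by (simp add: Lambda2_2_def vec_eq_iff[of "wedge22 _ _"])
qed

lemma mm_iff: "\<beta> \<in> mm \<longleftrightarrow> \<beta> \<in> Lambda2 \<and> \<beta>$1$2 = 0 \<and> \<beta>$3$4 = 0 \<and>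
  \<beta>$2$4 = - (\<beta>$1$3) \<and> \<beta>$2$3 = \<beta>$1$4" (is "_ = ?R")
proof
  assume ?R
  \<comment> \<open>The entries with an index 5 form the summand in \<open>Lambda2_4\<close>; what
    remains lies in \<open>Lambda2_2\<close>.\<close>
  define \<gamma> :: tensor2 where "\<gamma> = (\<chi> i j. if i = 5 \<or> j = 5 then \<beta>$i$j else 0)"
  have "\<beta> - \<gamma> \<in> Lambda2_2" "\<gamma> \<in> Lambda2_4"
    using \<open>?R\<close> by (simp_all add: Lambda2_2_iff Lambda2_4_iff Lambda2_iff \<gamma>_def)
  then show "\<beta> \<in> mm" unfolding mm_def by (metis (mono_tags, lifting) diff_add_cancel mem_Collect_eq)
next
  assume "\<beta> \<in> mm"
  then obtain \<alpha> \<gamma> where *: "\<beta> = \<alpha> + \<gamma>" "\<alpha> \<in> Lambda2_2" "\<gamma> \<in> Lambda2_4"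
    by (auto simp: mm_def)
  note [simp] = *(2)[unfolded Lambda2_2_iff Lambda2_iff] *(3)[unfolded Lambda2_4_iff Lambda2_iff]
  show ?R by (simp add: *(1) Lambda2_iff)
qed

text \<open>On antisymmetric arguments this is the orthogonal projection onto \<open>mm\<close>: by
  \<open>mm_iff\<close> the pair (13, 24) is projected onto its antidiagonal and the pair (14, 23)
  onto its diagonal.\<close>

definition proj_m :: "tensor2 \<Rightarrow> tensor2" where
  "proj_m \<alpha> = (\<chi> i j. if i = 5 \<or> j = 5 then \<alpha>$i$j
     else if (i, j) \<in> {(1, 3), (4, 2)} then (\<alpha>$1$3 - \<alpha>$2$4) / 2
     else if (i, j) \<in> {(3, 1), (2, 4)} then (\<alpha>$2$4 - \<alpha>$1$3) / 2
     else if (i, j) \<in> {(1, 4), (2, 3)} then (\<alpha>$1$4 + \<alpha>$2$3) / 2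
     else if (i, j) \<in> {(4, 1), (3, 2)} then - (\<alpha>$1$4 + \<alpha>$2$3) / 2
     else 0)"

lemma pr_m_eq:
  assumes "\<alpha> \<in> Lambda2"
  shows "pr_m \<alpha> = proj_m \<alpha>"
  unfolding pr_m_def
proof (rule the_equality)
  have *: "proj_m \<alpha> \<in> mm"
    using assms by (simp add: mm_iff Lambda2_iff proj_m_def field_simps)
  have **: "(\<alpha> - proj_m \<alpha>) \<bullet> \<gamma> = 0" if "\<gamma> \<in> mm" for \<gamma>
    using that assms by (simp add: mm_iff Lambda2_iff proj_m_def inner_vec_def sum_5 field_simps)
  show "proj_m \<alpha> \<in> mm \<and> (\<forall>\<gamma>\<in>mm. (\<alpha> - proj_m \<alpha>) \<bullet> \<gamma> = 0)" using * ** by blast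
  fix \<beta> assume \<beta>: "\<beta> \<in> mm \<and> (\<forall>\<gamma>\<in>mm. (\<alpha> - \<beta>) \<bullet> \<gamma> = 0)"
  \<comment> \<open>Uniqueness: the difference of two candidates lies in \<open>mm\<close> and is
    orthogonal to \<open>mm\<close>, hence to itself.\<close>
  have "\<beta> - proj_m \<alpha> \<in> mm" using * \<beta> by (simp add: mm_iff Lambda2_iff)
  then have "(\<beta> - proj_m \<alpha>) \<bullet> (\<beta> - proj_m \<alpha>) = 0"
    using ** \<beta> by (metis (no_types, lifting) diff_diff_eq2 diff_add_cancel inner_diff_left diff_self)
  then show "\<beta> = proj_m \<alpha>" by simp
qed

text \<open>The subalgebra u(2) in coordinates, that is, the kernel of \<open>pr_m\<close> on
  \<open>Lambda2\<close>; the entries 12 and 34 stay free.\<close>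

definition u2_forms :: "tensor2 set" where
  "u2_forms = {\<beta> \<in> Lambda2. (\<forall>k. \<beta>$5$k = 0) \<and> \<beta>$1$3 = \<beta>$2$4 \<and> \<beta>$1$4 = - (\<beta>$2$3)}"

lemma pr_m_eq_iff:
  assumes "\<alpha> \<in> Lambda2" "\<beta> \<in> Lambda2"
  shows "pr_m \<alpha> = pr_m \<beta> \<longleftrightarrow> \<alpha> - \<beta> \<in> u2_forms"
  using assms unfolding pr_m_eq[OF assms(1)] pr_m_eq[OF assms(2)]
  by (simp add: u2_forms_def Lambda2_iff proj_m_def vec_eq_iff forall_5) argo

section \<open>The classes as conditions modulo u(2)\<close>

lemma theta0_Lambda2: "theta0 a $ i \<in> Lambda2"
  by (simp add: theta0_def Lambda2_def)

lemma pr_W_add: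
  assumes "\<And>i. X $ i \<in> Lambda2" "\<And>i. Y $ i \<in> Lambda2"
  shows "pr_W (X + Y) = pr_W X + pr_W Y"
proof -
  have "pr_m (X $ i + Y $ i) = pr_m (X $ i) + pr_m (Y $ i)" for i
  proof -
    have "X $ i + Y $ i \<in> Lambda2" using assms[of i] by (simp add: Lambda2_iff)
    then show ?thesis using assms[of i]
      by (simp add: pr_m_eq) (simp add: proj_m_def vec_eq_iff forall_5 field_simps)
  qed
  then show ?thesis by (simp add: pr_W_def vec_eq_iff)
qed

lemma theta0_add: "theta0 (a + b) = theta0 a + theta0 b"
  by (simp add: theta0_def vec_eq_iff algebra_simps)

lemma Lambda1_1_iff: "a \<in> Lambda1_1 \<longleftrightarrow> (\<forall>i. i \<noteq> 5 \<longrightarrow> a $ i = 0)"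
proof
  assume "\<forall>i. i \<noteq> 5 \<longrightarrow> a $ i = 0"
  then have "a = (a $ 5) *\<^sub>R eta0" by (simp add: vec_eq_iff eta0_nth)
  then show "a \<in> Lambda1_1" unfolding Lambda1_1_def by (metis span_base span_scale singletonI)
qed (auto simp: Lambda1_1_def span_singleton eta0_nth)

text \<open>Each 2-form \<open>theta0 a $ i\<close> is the wedge of the basis form with index
  \<open>i\<close> and a multiple of \<open>eta0\<close>, so only entries with an index 5 survive
  and it already lies in \<open>mm\<close>. This lets \<open>W1\<close> be written with the
  projection, in the same shape as \<open>W2\<close>.\<close>

lemma pr_W_theta0_eta:
  assumes "a \<in> Lambda1_1"
  shows "pr_W (theta0 a) = theta0 a"
proof -
  have "proj_m (theta0 a $ i) = theta0 a $ i" for i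
    using assms exhaust_5[of i]
    by (auto simp add: Lambda1_1_iff proj_m_def theta0_def vec_eq_iff forall_5 mat_def)
  then show ?thesis by (simp add: pr_W_def vec_eq_iff pr_m_eq theta0_Lambda2)
qed

lemma W1_eq: "W1 = (pr_W \<circ> theta0) ` Lambda1_1"
  unfolding W1_def by (rule image_cong) (simp_all add: pr_W_theta0_eta)

text \<open>Every 1-form splits into a part in \<open>Lambda1_1\<close> and a part in
  \<open>Lambda1_2\<close>, and \<open>pr_W\<close> after \<open>theta0\<close> is additive. The
  class therefore asks for an arbitrary 1-form.\<close>

lemma W1_plus_W2_eq: "W1_plus_W2 = range (pr_W \<circ> theta0)"
proof -
  have *: "pr_W (theta0 a) + pr_W (theta0 b) = pr_W (theta0 (a + b))" for a b
    by (simp add: theta0_add pr_W_add theta0_Lambda2)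
  have "\<exists>b c. a = b + c \<and> b \<in> Lambda1_1 \<and> c \<in> Lambda1_2" for a
    by (rule exI[of _ "(a $ 5) *\<^sub>R eta0"], rule exI[of _ "a - (a $ 5) *\<^sub>R eta0"])
      (simp add: Lambda1_1_iff Lambda1_2_def eta0_nth)
  then show ?thesis
    unfolding W1_plus_W2_def W1_eq W2_def using * by (auto simp: image_iff) metis+
qed

lemma pr_W_eq_iff:
  assumes "\<And>i. X $ i \<in> Lambda2" "\<And>i. Y $ i \<in> Lambda2"
  shows "pr_W X = pr_W Y \<longleftrightarrow> (\<forall>i. X $ i - Y $ i \<in> u2_forms)"
  using assms by (simp add: pr_W_def vec_eq_iff[of "vec_lambda _"] pr_m_eq_iff)

lemma pr_W_mem_iff:
  assumes "\<And>i. X $ i \<in> Lambda2"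
  shows "pr_W X \<in> (pr_W \<circ> theta0) ` S \<longleftrightarrow> (\<exists>a\<in>S. \<forall>i. X $ i - theta0 a $ i \<in> u2_forms)"
  using pr_W_eq_iff[OF assms theta0_Lambda2] by auto

text \<open>Elements of u(2) commute with the endomorphism whose matrix is \<open>Phi0\<close>. The
  index pattern is the one met when \<open>\<phi>\<close> is differentiated in an adapted
  frame.\<close>

lemma u2_forms_commute:
  assumes "\<beta> \<in> u2_forms"
  shows "(\<Sum>l\<in>UNIV. Phi0 $ l $ j * \<beta> $ l $ k) = (\<Sum>l\<in>UNIV. \<beta> $ j $ l * Phi0 $ k $ l)"
proof -
  note [simp] = assms[unfolded u2_forms_def Lambda2_iff mem_Collect_eq]
  have [simp]: "\<beta> $ 1 $ 5 = 0" "\<beta> $ 2 $ 5 = 0" "\<beta> $ 3 $ 5 = 0" "\<beta> $ 4 $ 5 = 0"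
    using assms[unfolded u2_forms_def Lambda2_iff mem_Collect_eq] by (metis neg_equal_0_iff_equal)+
  have "\<forall>j k. (\<Sum>l\<in>UNIV. Phi0 $ l $ j * \<beta> $ l $ k) = (\<Sum>l\<in>UNIV. \<beta> $ j $ l * Phi0 $ k $ l)"
    unfolding forall_5 by (simp add: sum_5 Phi0_nth)
  then show ?thesis by blast
qed

section \<open>Smooth functions and tangent vectors\<close>

lemma Ck_on_subset: "Ck_on k S f \<Longrightarrow> T \<subseteq> S \<Longrightarrow> Ck_on k T f"
  by (induction k arbitrary: f) (auto intro: continuous_on_subset)

lemma Ck_on_SucD: "Ck_on (Suc k) S f \<Longrightarrow> Ck_on k S f"
proof (induction k arbitrary: f)
  case 0
  then show ?case
    by (auto intro!: differentiable_imp_continuous_on simp: differentiable_on_def differentiable_at_withinI)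
next
  case (Suc k)
  then show ?case by (metis Ck_on.simps(2))
qed

text \<open>Since \<open>S\<close> is open, functions that agree on \<open>S\<close> also have the
  same derivatives at its points, so the induction can pass to them.\<close>

lemma Ck_on_cong:
  assumes "open S" "\<And>x. x \<in> S \<Longrightarrow> f x = h x" "Ck_on k S f"
  shows "Ck_on k S h"
  using assms(2,3)
proof (induction k arbitrary: f h)
  case 0
  then show ?case using continuous_on_cong by force
next
  case (Suc k)
  have d: "(h has_derivative frechet_derivative f (at x)) (at x)" if "x \<in> S" for x
  proof (rule has_derivative_transform_within_open[OF _ assms(1) that])
    show "(f has_derivative frechet_derivative f (at x)) (at x)"
      using Suc.prems(2) that by (intro frechet_derivative_works[THEN iffD1]) auto
  qed (use Suc.prems(1) in auto)
  then have e: "frechet_derivative f (at x) = frechet_derivative h (at x)" if "x \<in> S" for x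
    using that frechet_derivative_at by blast
  have D: "Ck_on k S (\<lambda>x. frechet_derivative f (at x) v)" for v
    using Suc.prems by simp
  have "Ck_on k S (\<lambda>x. frechet_derivative h (at x) v)" for v
    by (rule Suc.IH[OF _ D]) (simp add: e)
  then show ?case using d by (auto simp: differentiable_def)
qed

lemma Ck_on_local:
  assumes "\<And>x. x \<in> S \<Longrightarrow> \<exists>T. open T \<and> x \<in> T \<and> Ck_on k T f"
  shows "Ck_on k S f"
  using assms
proof (induction k arbitrary: f)
  case 0
  then have "continuous (at x) f" if "x \<in> S" for x
    using that by (metis Ck_on.simps(1) continuous_on_eq_continuous_at)
  then show ?case by (simp add: continuous_at_imp_continuous_on)
next
  case (Suc k)
  have "Ck_on k S (\<lambda>x. frechet_derivative f (at x) v)" for v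
    using Suc.prems by (intro Suc.IH) fastforce
  moreover have "f differentiable (at x)" if "x \<in> S" for x
    using Suc.prems[OF that] by auto
  ultimately show ?case by simp
qed

lemma Ck_on_const: "Ck_on k S (\<lambda>_. c)"
  by (induction k arbitrary: c) simp_all

lemma Ck_on_add:
  assumes "open S" "Ck_on k S f" "Ck_on k S h"
  shows "Ck_on k S (\<lambda>x. f x + h x)"
  using assms(2,3)
proof (induction k arbitrary: f h)
  case 0
  then show ?case by (auto intro: continuous_on_add)
next
  case (Suc k)
  have d: "((\<lambda>x. f x + h x) has_derivative
      (\<lambda>v. frechet_derivative f (at x) v + frechet_derivative h (at x) v)) (at x)" if "x \<in> S" for x
    using Suc.prems that by (intro has_derivative_add frechet_derivative_works[THEN iffD1]) auto
  have "Ck_on k S (\<lambda>x. frechet_derivative (\<lambda>x. f x + h x) (at x) v)" for v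
  proof (rule Ck_on_cong[OF assms(1)])
    show "Ck_on k S (\<lambda>x. frechet_derivative f (at x) v + frechet_derivative h (at x) v)"
      using Suc by simp
    show "frechet_derivative f (at x) v + frechet_derivative h (at x) v =
        frechet_derivative (\<lambda>x. f x + h x) (at x) v" if "x \<in> S" for x
      using frechet_derivative_at[OF d[OF that]] by (rule fun_cong)
  qed
  then show ?case using d by (auto simp: differentiable_def)
qed

lemma Ck_on_mult:
  fixes f h :: "'a::euclidean_space \<Rightarrow> real"
  assumes "open S" "Ck_on k S f" "Ck_on k S h"
  shows "Ck_on k S (\<lambda>x. f x * h x)"
  using assms(2,3)
proof (induction k arbitrary: f h)
  case 0
  then show ?case by (auto intro: continuous_on_mult)
next
  case (Suc k)
  have d: "((\<lambda>x. f x * h x) has_derivative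
      (\<lambda>v. f x * frechet_derivative h (at x) v + frechet_derivative f (at x) v * h x)) (at x)" if "x \<in> S" for x
    using Suc.prems that by (intro has_derivative_mult frechet_derivative_works[THEN iffD1]) auto
  have "Ck_on k S (\<lambda>x. frechet_derivative (\<lambda>x. f x * h x) (at x) v)" for v
  proof (rule Ck_on_cong[OF assms(1)])
    show "Ck_on k S (\<lambda>x. f x * frechet_derivative h (at x) v + frechet_derivative f (at x) v * h x)"
      \<comment> \<open>The product rule keeps undifferentiated factors, whose regularity must first
        be lowered by one order.\<close>
      using Suc.prems Suc.prems[THEN Ck_on_SucD] by (intro Ck_on_add assms(1) Suc.IH) simp_all
    show "f x * frechet_derivative h (at x) v + frechet_derivative f (at x) v * h x =
        frechet_derivative (\<lambda>x. f x * h x) (at x) v" if "x \<in> S" for x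
      using frechet_derivative_at[OF d[OF that]] by (rule fun_cong)
  qed
  then show ?case using d by (auto simp: differentiable_def)
qed

locale smooth_manifold =
  fixes A :: "'m::{t2_space, second_countable_topology} chart set"
  assumes atlas: "smooth_atlas A"
begin

section \<open>Smooth functions on the manifold\<close>

lemma chart:
  assumes "(V, c) \<in> A"
  shows "open (c ` V)" "homeomorphism V (c ` V) c (inv_into V c)"
  using atlas assms unfolding smooth_atlas_def by blast+

lemma chart_inj: "(V, c) \<in> A \<Longrightarrow> inj_on c V"
  using homeomorphism_apply1[OF chart(2)] by (rule inj_on_inverseI)

lemma open_chart_image:
  assumes "(V, c) \<in> A" "open U"
  shows "open (c ` (U \<inter> V))"
proof -
  have "open (c ` V \<inter> inv_into V c -` U)"
    using homeomorphism_cont2[OF chart(2)[OF assms(1)]] chart(1)[OF assms(1)] assms(2)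
    by (rule continuous_open_preimage)
  moreover have "c ` V \<inter> inv_into V c -` U = c ` (U \<inter> V)"
    using chart_inj[OF assms(1)] by auto
  ultimately show ?thesis by simp
qed

lemma smooth_fun_on_subset:
  assumes "smooth_fun_on A U f" "V \<subseteq> U" "open V"
  shows "smooth_fun_on A V f"
  unfolding smooth_fun_on_def Cinf_on_def
proof (safe intro!: assms(3))
  fix W c k assume "(W, c) \<in> A"
  then have "Ck_on k (c ` (U \<inter> W)) (f \<circ> inv_into W c)"
    using assms(1) by (auto simp: smooth_fun_on_def Cinf_on_def)
  then show "Ck_on k (c ` (V \<inter> W)) (f \<circ> inv_into W c)"
    by (rule Ck_on_subset) (use assms(2) in blast)
qed

lemma smooth_fun_on_cong:
  assumes "smooth_fun_on A U f" "\<And>q. q \<in> U \<Longrightarrow> f q = h q"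
  shows "smooth_fun_on A U h"
  unfolding smooth_fun_on_def Cinf_on_def
proof (safe)
  show "open U" using assms by (simp add: smooth_fun_on_def)
  fix V c k assume V: "(V, c) \<in> A"
  show "Ck_on k (c ` (U \<inter> V)) (h \<circ> inv_into V c)"
  proof (rule Ck_on_cong)
    show "open (c ` (U \<inter> V))" using open_chart_image[OF V] assms by (simp add: smooth_fun_on_def)
    show "Ck_on k (c ` (U \<inter> V)) (f \<circ> inv_into V c)"
      using assms V by (auto simp: smooth_fun_on_def Cinf_on_def)
  qed (use assms(2) chart_inj[OF V] in auto)
qed

lemma smooth_fun_on_local:
  assumes "open U" "\<And>p. p \<in> U \<Longrightarrow> \<exists>V. p \<in> V \<and> smooth_fun_on A V f"
  shows "smooth_fun_on A U f"
  unfolding smooth_fun_on_def Cinf_on_def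
proof (safe intro!: assms(1))
  fix V c k assume V: "(V, c) \<in> A"
  show "Ck_on k (c ` (U \<inter> V)) (f \<circ> inv_into V c)"
  proof (rule Ck_on_local)
    fix x assume "x \<in> c ` (U \<inter> V)"
    then obtain p where p: "x = c p" "p \<in> U" "p \<in> V" by blast
    then obtain W where W: "p \<in> W" "smooth_fun_on A W f" using assms(2) by blast
    then show "\<exists>T. open T \<and> x \<in> T \<and> Ck_on k T (f \<circ> inv_into V c)"
      using V p open_chart_image[OF V, of W]
      by (intro exI[of _ "c ` (W \<inter> V)"]) (auto simp: smooth_fun_on_def Cinf_on_def)
  qed
qed

lemma smooth_fun_on_const: "open U \<Longrightarrow> smooth_fun_on A U (\<lambda>_. c)"
  by (auto simp: smooth_fun_on_def Cinf_on_def comp_def Ck_on_const)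

lemma smooth_fun_on_add:
  "smooth_fun_on A U f \<Longrightarrow> smooth_fun_on A U h \<Longrightarrow> smooth_fun_on A U (\<lambda>q. f q + h q)"
  using open_chart_image by (fastforce simp: smooth_fun_on_def Cinf_on_def comp_def intro!: Ck_on_add)

lemma smooth_fun_on_mult:
  "smooth_fun_on A U f \<Longrightarrow> smooth_fun_on A U h \<Longrightarrow> smooth_fun_on A U (\<lambda>q. f q * h q)"
  using open_chart_image by (fastforce simp: smooth_fun_on_def Cinf_on_def comp_def intro!: Ck_on_mult)

lemma smooth_near_cong:
  assumes "smooth_near A p f" "open U" "p \<in> U" "\<And>q. q \<in> U \<Longrightarrow> f q = h q"
  shows "smooth_near A p h"
proof -
  obtain V where V: "p \<in> V" "smooth_fun_on A V f" using assms(1) by (auto simp: smooth_near_def)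
  then have "open (U \<inter> V)" using assms(2) by (auto simp: smooth_fun_on_def)
  then have "smooth_fun_on A (U \<inter> V) h"
    using smooth_fun_on_cong[OF smooth_fun_on_subset[OF V(2)], of "U \<inter> V" h] assms(4) by blast
  then show ?thesis using V assms(3) by (auto simp: smooth_near_def)
qed

lemma smooth_near_const: "smooth_near A p (\<lambda>_. c)"
  using smooth_fun_on_const[of UNIV c] by (auto simp: smooth_near_def)

lemma smooth_near_add_mult:
  assumes "smooth_near A p f" "smooth_near A p h"
  shows "smooth_near A p (\<lambda>q. f q + h q)" "smooth_near A p (\<lambda>q. f q * h q)"
proof -
  obtain V W where V: "p \<in> V" "smooth_fun_on A V f" "p \<in> W" "smooth_fun_on A W h"
    using assms by (auto simp: smooth_near_def)
  then have "open (V \<inter> W)" by (auto simp: smooth_fun_on_def)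
  then have "smooth_fun_on A (V \<inter> W) f" "smooth_fun_on A (V \<inter> W) h"
    using V smooth_fun_on_subset by (meson inf_le1 inf_le2)+
  then show "smooth_near A p (\<lambda>q. f q + h q)" "smooth_near A p (\<lambda>q. f q * h q)"
    using smooth_fun_on_add smooth_fun_on_mult V by (auto simp: smooth_near_def)
qed

section \<open>Locality of derivations\<close>

lemma smooth_near_indicator:
  assumes "open U" "p \<in> U"
  shows "smooth_near A p (indicator U)"
  using smooth_near_cong[OF smooth_near_const[of p 1] assms] by simp

text \<open>An indicator function is idempotent, so at a point of \<open>U\<close> the Leibniz rule
  equates the value with twice itself.\<close>

lemma tangent_indicator:
  assumes "v \<in> tangent A p" "open U" "p \<in> U"
  shows "v (indicator U) = 0"
proof -
  have "(\<lambda>q. indicator U q * indicator U q :: real) = indicator U"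
    by (auto simp: indicator_def)
  moreover have "v (\<lambda>q. indicator U q * indicator U q) =
      indicator U p * v (indicator U) + indicator U p * v (indicator U)"
    using assms(1) smooth_near_indicator[OF assms(2,3)] unfolding tangent_def by blast
  ultimately show ?thesis using assms(3) by simp
qed

lemma tangent_const: "v \<in> tangent A p \<Longrightarrow> v (\<lambda>_. c) = 0"
proof -
  assume v: "v \<in> tangent A p"
  then have "v (\<lambda>q. c * 1 + 0 * 1) = c * v (\<lambda>_. 1) + 0 * v (\<lambda>_. 1)"
    using smooth_near_const[of p 1] unfolding tangent_def by blast
  moreover have "v (\<lambda>_. 1) = 0"
    using tangent_indicator[OF v, of UNIV] by (simp add: indicator_def)
  ultimately show ?thesis by simp
qed

text \<open>By the Leibniz rule, multiplying by the indicator of \<open>U\<close> does not change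
  the value of \<open>v\<close>, and after multiplication the two functions are equal
  everywhere.\<close>

lemma tangent_cong:
  assumes v: "v \<in> tangent A p" and U: "open U" "p \<in> U" "\<And>q. q \<in> U \<Longrightarrow> f q = h q"
  shows "v f = v h"
proof (cases "smooth_near A p f")
  case True
  then have h: "smooth_near A p h" using smooth_near_cong U by blast
  have prod: "v (\<lambda>q. indicator U q * k q) = v k" if "smooth_near A p k" for k
  proof -
    have "v (\<lambda>q. indicator U q * k q) = indicator U p * v k + k p * v (indicator U)"
      using v that smooth_near_indicator[OF U(1,2)] unfolding tangent_def by blast
    then show ?thesis using tangent_indicator[OF v U(1,2)] U(2) by simp
  qed
  have "(\<lambda>q. indicator U q * f q) = (\<lambda>q. indicator U q * h q)"
    using U(3) by (auto simp: indicator_def)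
  then show ?thesis using prod[OF True] prod[OF h] by simp
next
  case False
  \<comment> \<open>Neither function is smooth near \<open>p\<close>, and both are sent to the
    default value 0.\<close>
  then have "\<not> smooth_near A p h" using smooth_near_cong[of p h U f] U by metis
  then show ?thesis using False v by (simp add: tangent_def)
qed

lemma tangent_lincomb:
  assumes "v \<in> tangent A p" "w \<in> tangent A p"
  shows "lincomb a v b w \<in> tangent A p"
  using assms by (simp add: tangent_def lincomb_def algebra_simps)

lemma tangent_zero: "(\<lambda>_. 0) \<in> tangent A p"
  by (simp add: tangent_def)

lemma tangent_sum:
  assumes "finite I" "\<And>i. i \<in> I \<Longrightarrow> b i \<in> tangent A p"
  shows "(\<lambda>f. \<Sum>i\<in>I. c i * b i f) \<in> tangent A p"
  using assms
proof (induction I)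
  case (insert i I)
  then have "lincomb (c i) (b i) 1 (\<lambda>f. \<Sum>i\<in>I. c i * b i f) \<in> tangent A p"
    by (intro tangent_lincomb) auto
  then show ?case using insert by (simp add: lincomb_def)
qed (simp add: tangent_zero)

lemma linear_tangent_sum:
  fixes L :: "'m tvec \<Rightarrow> real"
  assumes "\<And>v w a b. v \<in> tangent A p \<Longrightarrow> w \<in> tangent A p \<Longrightarrow> L (lincomb a v b w) = a * L v + b * L w"
    and "finite I" "\<And>i. i \<in> I \<Longrightarrow> b i \<in> tangent A p"
  shows "L (\<lambda>f. \<Sum>i\<in>I. c i * b i f) = (\<Sum>i\<in>I. c i * L (b i))"
  using assms(2,3)
proof (induction I)
  case empty
  then show ?case using assms(1)[OF tangent_zero tangent_zero, of 0 0] by (simp add: lincomb_def)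
next
  case (insert i I)
  then have "L (lincomb (c i) (b i) 1 (\<lambda>f. \<Sum>i\<in>I. c i * b i f)) = (\<Sum>i\<in>insert i I. c i * L (b i))"
    by (subst assms(1)) (auto intro: tangent_sum)
  then show ?case using insert by (simp add: lincomb_def)
qed

section \<open>Local vector fields\<close>

lemma vfield_on_subset:
  "vfield_on A U X \<Longrightarrow> V \<subseteq> U \<Longrightarrow> open V \<Longrightarrow> vfield_on A V X"
  unfolding vfield_on_def by blast

lemma vfield_on_lincomb:
  assumes "vfield_on A U X" "vfield_on A U Y" "smooth_fun_on A U f" "smooth_fun_on A U h"
  shows "vfield_on A U (\<lambda>q. lincomb (f q) (X q) (h q) (Y q))"
  unfolding vfield_on_def
proof (intro conjI ballI allI impI)
  show "open U" using assms by (simp add: vfield_on_def)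
  show "lincomb (f q) (X q) (h q) (Y q) \<in> tangent A q" if "q \<in> U" for q
    using assms that by (simp add: vfield_on_def tangent_lincomb)
  fix V k assume V: "V \<subseteq> U" "smooth_fun_on A V k"
  then have "open V" by (simp add: smooth_fun_on_def)
  then show "smooth_fun_on A V (\<lambda>q. lincomb (f q) (X q) (h q) (Y q) k)"
    unfolding lincomb_def using assms(1,2)[unfolded vfield_on_def] V
    by (intro smooth_fun_on_add smooth_fun_on_mult smooth_fun_on_subset[OF assms(3)]
        smooth_fun_on_subset[OF assms(4)]) simp_all
qed

lemma vfield_near_lincomb:
  assumes "vfield_near A p X" "vfield_near A p Y" "smooth_near A p f" "smooth_near A p h"
  shows "vfield_near A p (\<lambda>q. lincomb (f q) (X q) (h q) (Y q))"
proof -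
  obtain U V W S where *: "p \<in> U" "vfield_on A U X" "p \<in> V" "vfield_on A V Y"
    "p \<in> W" "smooth_fun_on A W f" "p \<in> S" "smooth_fun_on A S h"
    using assms by (auto simp: vfield_near_def smooth_near_def)
  define O' where "O' = U \<inter> V \<inter> W \<inter> S"
  have "open U" "open V" "open W" "open S" using * by (simp_all add: vfield_on_def smooth_fun_on_def)
  then have "open O'" by (simp add: O'_def open_Int)
  then have "vfield_on A O' X" "vfield_on A O' Y" "smooth_fun_on A O' f" "smooth_fun_on A O' h"
    using * by (auto intro: vfield_on_subset smooth_fun_on_subset simp: O'_def)
  then have "vfield_on A O' (\<lambda>q. lincomb (f q) (X q) (h q) (Y q))" by (rule vfield_on_lincomb)
  moreover have "p \<in> O'" using * by (simp add: O'_def)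
  ultimately show ?thesis by (auto simp: vfield_near_def)
qed

lemma vfield_near_scale:
  assumes "vfield_near A p X" "smooth_near A p f"
  shows "vfield_near A p (\<lambda>q h. f q * X q h)"
  using vfield_near_lincomb[OF assms(1) assms(1) assms(2) smooth_near_const[of p 0]]
  by (simp add: lincomb_def)

lemma vfield_near_zero: "vfield_near A p (\<lambda>_ _. 0)"
  unfolding vfield_near_def vfield_on_def using tangent_zero smooth_fun_on_const
  by (intro exI[of _ UNIV]) (auto simp: smooth_fun_on_def)

lemma vfield_near_sum:
  assumes "finite I" "\<And>i. i \<in> I \<Longrightarrow> vfield_near A p (e i)"
  shows "vfield_near A p (\<lambda>q f. \<Sum>i\<in>I. c i * e i q f)"
  using assms
proof (induction I)
  case (insert i I)
  then have "vfield_near A p (\<lambda>q. lincomb (c i) (e i q) 1 (\<lambda>f. \<Sum>i\<in>I. c i * e i q f))"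
    by (intro vfield_near_lincomb) (auto intro: smooth_near_const)
  then show ?case using insert by (simp add: lincomb_def)
qed (simp add: vfield_near_zero)

lemma vfield_on_cong:
  assumes "vfield_on A U X" "\<And>q. q \<in> U \<Longrightarrow> X q = Y q"
  shows "vfield_on A U Y"
  unfolding vfield_on_def
proof (intro conjI ballI allI impI)
  show "open U" using assms by (simp add: vfield_on_def)
  show "Y q \<in> tangent A q" if "q \<in> U" for q
    using that assms(1) assms(2)[OF that] by (auto simp: vfield_on_def)
  fix V k assume V: "V \<subseteq> U" "smooth_fun_on A V k"
  then have "smooth_fun_on A V (\<lambda>q. X q k)" using assms(1) by (simp add: vfield_on_def)
  then show "smooth_fun_on A V (\<lambda>q. Y q k)"
    by (rule smooth_fun_on_cong) (use V assms(2) in auto)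
qed

lemma vfield_near_cong:
  assumes "vfield_near A p X" "open U" "p \<in> U" "\<And>q. q \<in> U \<Longrightarrow> X q = Y q"
  shows "vfield_near A p Y"
proof -
  obtain W where W: "p \<in> W" "vfield_on A W X" using assms(1) by (auto simp: vfield_near_def)
  have "open (U \<inter> W)" using W assms(2) by (auto simp: vfield_on_def)
  then have "vfield_on A (U \<inter> W) X" by (rule vfield_on_subset[OF W(2) Int_lower2])
  then have "vfield_on A (U \<inter> W) Y" by (rule vfield_on_cong) (simp add: assms(4))
  then show ?thesis using W(1) assms(3) unfolding vfield_near_def by blast
qed

lemma tangent_uminus:
  assumes "v \<in> tangent A p"
  shows "v (\<lambda>q. - f q) = - v f"
proof (cases "smooth_near A p f")
  case True
  then have "v (\<lambda>q. (- 1) * f q + 0 * f q) = (- 1) * v f + 0 * v f"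
    using assms unfolding tangent_def by blast
  then show ?thesis by simp
next
  case False
  then have "\<not> smooth_near A p (\<lambda>q. - f q)"
    using smooth_near_add_mult(2)[OF smooth_near_const[of p "- 1"], of "\<lambda>q. - f q"] by auto
  then show ?thesis using False assms by (simp add: tangent_def)
qed

lemma vfield_near_tangent: "vfield_near A p X \<Longrightarrow> X p \<in> tangent A p"
  by (auto simp: vfield_near_def vfield_on_def)

end

section \<open>Metric connections and the covariant derivative of \<open>\<xi>\<close>\<close>

locale riemannian_manifold = smooth_manifold A
  for A :: "'m::{t2_space, second_countable_topology} chart set" +
  fixes g :: "'m metric"
  assumes riemannian: "riemannian_metric A g"
begin

lemma g_sym: "v \<in> tangent A p \<Longrightarrow> w \<in> tangent A p \<Longrightarrow> g p v w = g p w v"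
  using riemannian unfolding riemannian_metric_def by blast

lemma g_lincomb_left:
  "u \<in> tangent A p \<Longrightarrow> v \<in> tangent A p \<Longrightarrow> w \<in> tangent A p \<Longrightarrow>
    g p (lincomb a u b v) w = a * g p u w + b * g p v w"
  using riemannian unfolding riemannian_metric_def by blast

lemma g_lincomb_right:
  "u \<in> tangent A p \<Longrightarrow> v \<in> tangent A p \<Longrightarrow> w \<in> tangent A p \<Longrightarrow>
    g p w (lincomb a u b v) = a * g p w u + b * g p w v"
  by (simp add: g_sym[of w] tangent_lincomb g_lincomb_left)

lemma g_zero: "v \<in> tangent A p \<Longrightarrow> g p (\<lambda>_. 0) v = 0"
  using g_lincomb_left[of v p v v 0 0] by (simp add: lincomb_def)

lemma g_smooth:
  "vfield_on A U X \<Longrightarrow> vfield_on A U Y \<Longrightarrow> smooth_fun_on A U (\<lambda>q. g q (X q) (Y q))"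
  using riemannian unfolding riemannian_metric_def by blast

text \<open>Positivity is applied to the difference of the two vectors. Vector identities for
  connections are checked this way, by pairing with test vectors.\<close>

lemma g_nondegenerate:
  assumes "v \<in> tangent A p" "w \<in> tangent A p" "\<And>z. z \<in> tangent A p \<Longrightarrow> g p v z = g p w z"
  shows "v = w"
proof -
  let ?d = "lincomb 1 v (- 1) w"
  have d: "?d \<in> tangent A p" using assms by (simp add: tangent_lincomb)
  then have "g p ?d ?d = 0" using assms by (simp add: g_lincomb_left)
  then have "?d = (\<lambda>_. 0)"
    using d riemannian unfolding riemannian_metric_def by (metis less_irrefl)
  then show ?thesis by (auto simp: lincomb_def fun_eq_iff)
qed

lemma orthonormal_expansion:
  assumes b: "orthonormal_basis A g p b" and v: "v \<in> tangent A p"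
  shows "v = (\<lambda>f. \<Sum>i\<in>UNIV. g p (b i) v * b i f)"
proof -
  have t: "b i \<in> tangent A p" for i using b by (simp add: orthonormal_basis_def)
  obtain c where c: "v = (\<lambda>f. \<Sum>i\<in>UNIV. c i * b i f)"
    using b v unfolding orthonormal_basis_def by blast
  have "g p (b j) v = c j" for j
  proof -
    have "g p (b j) v = (\<Sum>i\<in>UNIV. c i * g p (b j) (b i))"
      unfolding c by (rule linear_tangent_sum[where p = p]) (simp_all add: t g_lincomb_right)
    also have "\<dots> = (\<Sum>i\<in>UNIV. if j = i then c i else 0)"
      using b by (intro sum.cong) (auto simp: orthonormal_basis_def)
    finally show ?thesis by simp
  qed
  then show ?thesis using c by simp
qed

lemma linear_expansion:
  fixes L :: "'m tvec \<Rightarrow> real"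
  assumes b: "orthonormal_basis A g p b" and v: "v \<in> tangent A p"
    and L: "\<And>v w a b. v \<in> tangent A p \<Longrightarrow> w \<in> tangent A p \<Longrightarrow> L (lincomb a v b w) = a * L v + b * L w"
  shows "L v = (\<Sum>i\<in>UNIV. g p (b i) v * L (b i))"
proof -
  have "L v = L (\<lambda>f. \<Sum>i\<in>UNIV. g p (b i) v * b i f)"
    using orthonormal_expansion[OF b v] by simp
  also have "\<dots> = (\<Sum>i\<in>UNIV. g p (b i) v * L (b i))"
    using b by (intro linear_tangent_sum[where p = p] L) (simp_all add: orthonormal_basis_def)
  finally show ?thesis .
qed

lemma linear_eq_on_basis:
  fixes L M :: "'m tvec \<Rightarrow> real"
  assumes "orthonormal_basis A g p b" "v \<in> tangent A p"
    and "\<And>v w a b. v \<in> tangent A p \<Longrightarrow> w \<in> tangent A p \<Longrightarrow> L (lincomb a v b w) = a * L v + b * L w"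
    and "\<And>v w a b. v \<in> tangent A p \<Longrightarrow> w \<in> tangent A p \<Longrightarrow> M (lincomb a v b w) = a * M v + b * M w"
    and "\<And>i. L (b i) = M (b i)"
  shows "L v = M v"
  using linear_expansion[OF assms(1,2), of L] linear_expansion[OF assms(1,2), of M] assms(3-5) by simp

end

section \<open>Calculus of connections\<close>

context smooth_manifold
begin

lemma
  assumes "connection A D"
  shows connection_tangent: "v \<in> tangent A p \<Longrightarrow> vfield_near A p Y \<Longrightarrow> D p v Y \<in> tangent A p"
    and connection_undefined: "\<not> (v \<in> tangent A p \<and> vfield_near A p Y) \<Longrightarrow> D p v Y = (\<lambda>_. 0)"
    and connection_lincomb: "vfield_near A p Y \<Longrightarrow> v \<in> tangent A p \<Longrightarrow> w \<in> tangent A p \<Longrightarrow>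
      D p (lincomb a v b w) Y = lincomb a (D p v Y) b (D p w Y)"
    and connection_add: "vfield_near A p Y \<Longrightarrow> vfield_near A p Z \<Longrightarrow> v \<in> tangent A p \<Longrightarrow>
      D p v (\<lambda>q. lincomb 1 (Y q) 1 (Z q)) = lincomb 1 (D p v Y) 1 (D p v Z)"
    and connection_scale: "smooth_near A p f \<Longrightarrow> vfield_near A p Y \<Longrightarrow> v \<in> tangent A p \<Longrightarrow>
      D p v (\<lambda>q h. f q * Y q h) = lincomb (f p) (D p v Y) (v f) (Y p)"
    and connection_smooth: "vfield_on A U X \<Longrightarrow> vfield_on A U Y \<Longrightarrow> vfield_on A U (\<lambda>q. D q (X q) Y)"
proof -
  note D = assms[unfolded connection_def]
  note c1 = D[THEN conjunct1] and D = D[THEN conjunct2]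
  note c2 = D[THEN conjunct1] and D = D[THEN conjunct2]
  note c3 = D[THEN conjunct1] and D = D[THEN conjunct2]
  note c4 = D[THEN conjunct1] and D = D[THEN conjunct2]
  note c5 = D[THEN conjunct1] and c6 = D[THEN conjunct2]
  show "v \<in> tangent A p \<Longrightarrow> vfield_near A p Y \<Longrightarrow> D p v Y \<in> tangent A p"
    using c1 by blast
  show "\<not> (v \<in> tangent A p \<and> vfield_near A p Y) \<Longrightarrow> D p v Y = (\<lambda>_. 0)"
    by (rule c2[rule_format])
  show "vfield_near A p Y \<Longrightarrow> v \<in> tangent A p \<Longrightarrow> w \<in> tangent A p \<Longrightarrow>
      D p (lincomb a v b w) Y = lincomb a (D p v Y) b (D p w Y)"
    by (rule c3[rule_format])
  show "vfield_near A p Y \<Longrightarrow> vfield_near A p Z \<Longrightarrow> v \<in> tangent A p \<Longrightarrow>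
      D p v (\<lambda>q. lincomb 1 (Y q) 1 (Z q)) = lincomb 1 (D p v Y) 1 (D p v Z)"
    by (rule c4[rule_format])
  show "smooth_near A p f \<Longrightarrow> vfield_near A p Y \<Longrightarrow> v \<in> tangent A p \<Longrightarrow>
      D p v (\<lambda>q h. f q * Y q h) = lincomb (f p) (D p v Y) (v f) (Y p)"
    by (rule c5[rule_format])
  show "vfield_on A U X \<Longrightarrow> vfield_on A U Y \<Longrightarrow> vfield_on A U (\<lambda>q. D q (X q) Y)"
    by (rule c6[rule_format])
qed

text \<open>The indicator argument of \<open>tangent_cong\<close> again: in the Leibniz rule for an
  indicator the derivative term vanishes, so the fields may be cut off to \<open>U\<close>.\<close>

lemma connection_cong:
  assumes D: "connection A D" and v: "v \<in> tangent A p" and X: "vfield_near A p X"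
    and U: "open U" "p \<in> U" "\<And>q. q \<in> U \<Longrightarrow> X q = Y q"
  shows "D p v X = D p v Y"
proof -
  have loc: "D p v (\<lambda>q h. indicator U q * Z q h) = D p v Z" if "vfield_near A p Z" for Z
    using connection_scale[OF D smooth_near_indicator[OF U(1,2)] that v]
      tangent_indicator[OF v U(1,2)] U(2) by (simp add: lincomb_def)
  have "(\<lambda>q h. indicator U q * X q h) = (\<lambda>q h. indicator U q * Y q h)"
    using U(3) by (auto simp: indicator_def fun_eq_iff)
  then show ?thesis using loc[OF X] loc[OF vfield_near_cong[OF X U]] by simp
qed

lemma connection_sum:
  assumes D: "connection A D" and v: "v \<in> tangent A p"
    and "finite I" "\<And>i. i \<in> I \<Longrightarrow> vfield_near A p (e i)"
  shows "D p v (\<lambda>q f. \<Sum>i\<in>I. c i * e i q f) = (\<lambda>f. \<Sum>i\<in>I. c i * D p v (e i) f)"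
  using assms(3,4)
proof (induction I)
  case empty
  then show ?case
    using connection_scale[OF D smooth_near_const[of p 0] vfield_near_zero v] tangent_const[OF v]
    by (simp add: lincomb_def)
next
  case (insert i I)
  let ?S = "\<lambda>q f. \<Sum>i\<in>I. c i * e i q f"
  have "D p v (\<lambda>q. lincomb 1 (\<lambda>h. c i * e i q h) 1 (?S q)) =
      lincomb 1 (D p v (\<lambda>q h. c i * e i q h)) 1 (D p v ?S)"
    using insert by (intro connection_add[OF D _ _ v] vfield_near_scale vfield_near_sum smooth_near_const) auto
  moreover have "D p v (\<lambda>q h. c i * e i q h) = lincomb (c i) (D p v (e i)) 0 (e i p)"
    using connection_scale[OF D smooth_near_const[of p "c i"] _ v, of "e i"] insert
    by (simp add: tangent_const[OF v])
  ultimately show ?case using insert by (simp add: lincomb_def)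
qed

end

text \<open>
  The existence of adapted frames, which the general theory provides, is an assumption here: it is
  part of \<^const>\<open>of_class\<close>.
\<close>
locale framed_acm_manifold = riemannian_manifold A g
  for A :: "'m::{t2_space, second_countable_topology} chart set" and g :: "'m metric" +
  fixes \<xi> :: "'m vfield" and \<eta> :: "'m oneform" and \<phi> :: "'m endo" and Dg :: "'m conn"
  assumes acm: "almost_contact_metric A g \<xi> \<eta> \<phi>"
    and lc: "levi_civita A g Dg"
    and frames: "\<exists>U e. p \<in> U \<and> adapted_frame_on A g \<xi> \<phi> U e"
begin

section \<open>Algebra of the almost contact metric structure\<close>

lemma xi_smooth: "vfield_on A UNIV \<xi>"
  and xi_unit: "g p (\<xi> p) (\<xi> p) = 1"
  and eta_eq: "v \<in> tangent A p \<Longrightarrow> \<eta> p v = g p (\<xi> p) v"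
  and phi_endo: "smooth_endo A \<phi>"
  and phi_xi: "\<phi> p (\<xi> p) = (\<lambda>_. 0)"
  and phi_phi: "v \<in> tangent A p \<Longrightarrow> \<phi> p (\<phi> p v) = lincomb (- 1) v (\<eta> p v) (\<xi> p)"
  and phi_metric: "v \<in> tangent A p \<Longrightarrow> w \<in> tangent A p \<Longrightarrow>
    g p (\<phi> p v) (\<phi> p w) = g p v w - \<eta> p v * \<eta> p w"
  using acm unfolding almost_contact_metric_def by blast+

lemma xi_near: "vfield_near A p \<xi>"
  using xi_smooth by (auto simp: vfield_near_def)

lemma xi_tangent: "\<xi> p \<in> tangent A p"
  using xi_near by (rule vfield_near_tangent)

lemma eta_xi: "\<eta> p (\<xi> p) = 1"
  by (simp add: eta_eq xi_tangent xi_unit)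

lemma eta_lincomb:
  "v \<in> tangent A p \<Longrightarrow> w \<in> tangent A p \<Longrightarrow> \<eta> p (lincomb a v b w) = a * \<eta> p v + b * \<eta> p w"
  by (simp add: eta_eq tangent_lincomb xi_tangent g_lincomb_right)

lemma phi_tangent: "v \<in> tangent A p \<Longrightarrow> \<phi> p v \<in> tangent A p"
  and phi_lincomb: "v \<in> tangent A p \<Longrightarrow> w \<in> tangent A p \<Longrightarrow>
    \<phi> p (lincomb a v b w) = lincomb a (\<phi> p v) b (\<phi> p w)"
  and phi_smooth: "vfield_on A U X \<Longrightarrow> vfield_on A U (\<lambda>q. \<phi> q (X q))"
  using phi_endo unfolding smooth_endo_def by blast+

lemma phi_near: "vfield_near A p X \<Longrightarrow> vfield_near A p (\<lambda>q. \<phi> q (X q))"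
  using phi_smooth by (auto simp: vfield_near_def)

text \<open>Computing the third power of \<open>\<phi>\<close> on \<open>v\<close> in two ways,
  through \<open>\<phi> p v\<close> and through \<open>v\<close>, leaves the multiple of
  \<open>\<xi> p\<close> with factor \<open>\<eta> p (\<phi> p v)\<close>, which must
  vanish.\<close>

lemma eta_phi:
  assumes "v \<in> tangent A p"
  shows "\<eta> p (\<phi> p v) = 0"
proof -
  have "\<phi> p (lincomb (- 1) v (\<eta> p v) (\<xi> p)) = lincomb (- 1) (\<phi> p v) (\<eta> p (\<phi> p v)) (\<xi> p)"
    using phi_phi[OF phi_tangent[OF assms]] phi_phi[OF assms] by simp
  then have "lincomb (- 1) (\<phi> p v) (\<eta> p v) (\<lambda>_. 0) = lincomb (- 1) (\<phi> p v) (\<eta> p (\<phi> p v)) (\<xi> p)"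
    by (simp add: phi_lincomb assms xi_tangent phi_xi)
  then have "(\<lambda>f. \<eta> p (\<phi> p v) * \<xi> p f) = (\<lambda>_. 0)"
    by (simp add: lincomb_def fun_eq_iff)
  then have "g p (lincomb (\<eta> p (\<phi> p v)) (\<xi> p) 0 (\<xi> p)) (\<xi> p) = 0"
    using g_zero[OF xi_tangent] by (simp add: lincomb_def)
  then show ?thesis by (simp add: g_lincomb_left xi_tangent xi_unit)
qed

text \<open>Apply \<open>phi_metric\<close> to \<open>v\<close> and \<open>\<phi> p w\<close>. The
  \<open>\<xi>\<close>-term of \<open>phi_phi\<close> drops out because the image of
  \<open>\<phi>\<close> is orthogonal to \<open>\<xi>\<close>.\<close>

lemma phi_skew:
  assumes "v \<in> tangent A p" "w \<in> tangent A p"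
  shows "g p (\<phi> p v) w = - g p v (\<phi> p w)"
proof -
  have "g p (\<phi> p v) (\<phi> p (\<phi> p w)) = g p v (\<phi> p w)"
    using phi_metric[OF assms(1) phi_tangent[OF assms(2)]] eta_phi[OF assms(2)] by simp
  moreover have "g p (\<phi> p v) (\<xi> p) = 0"
    using eta_phi[OF assms(1)] eta_eq[OF phi_tangent] g_sym xi_tangent phi_tangent assms(1) by metis
  ultimately show ?thesis
    using assms by (simp add: phi_phi g_lincomb_right phi_tangent xi_tangent)
qed

lemma metric_connection_Dg: "metric_connection A g Dg"
  using lc by (simp add: levi_civita_def)

lemma metric_rule:
  "metric_connection A g D \<Longrightarrow> vfield_near A p Y \<Longrightarrow> vfield_near A p Z \<Longrightarrow> v \<in> tangent A p \<Longrightarrow>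
    v (\<lambda>q. g q (Y q) (Z q)) = g p (D p v Y) (Z p) + g p (Y p) (D p v Z)"
  unfolding metric_connection_def by blast

lemma metric_connectionD: "metric_connection A g D \<Longrightarrow> connection A D"
  by (simp add: metric_connection_def)

lemmas connection_Dg = metric_connectionD[OF metric_connection_Dg]

lemma
  assumes "adapted_frame_on A g \<xi> \<phi> U e"
  shows frame_open: "open U"
    and frame_smooth: "vfield_on A U (e i)"
    and frame_near: "p \<in> U \<Longrightarrow> vfield_near A p (e i)"
    and frame_orthonormal: "p \<in> U \<Longrightarrow> orthonormal_basis A g p (\<lambda>i. e i p)"
    and frame_5: "p \<in> U \<Longrightarrow> e 5 p = \<xi> p"
    and frame_Phi: "p \<in> U \<Longrightarrow> g p (e i p) (\<phi> p (e j p)) = Phi0 $ i $ j"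
    and frame_tangent: "p \<in> U \<Longrightarrow> e i p \<in> tangent A p"
    and frame_g: "p \<in> U \<Longrightarrow> g p (e i p) (e j p) = (if i = j then 1 else 0)"
proof -
  show v: "vfield_on A U (e i)" for i using assms by (simp add: adapted_frame_on_def)
  then show "open U" by (simp add: vfield_on_def)
  show "p \<in> U \<Longrightarrow> vfield_near A p (e i)" using v by (auto simp: vfield_near_def)
  show b: "p \<in> U \<Longrightarrow> orthonormal_basis A g p (\<lambda>i. e i p)" using assms by (simp add: adapted_frame_on_def)
  show "p \<in> U \<Longrightarrow> e 5 p = \<xi> p" "p \<in> U \<Longrightarrow> g p (e i p) (\<phi> p (e j p)) = Phi0 $ i $ j"
    using assms by (simp_all add: adapted_frame_on_def)
  show "p \<in> U \<Longrightarrow> e i p \<in> tangent A p" "p \<in> U \<Longrightarrow> g p (e i p) (e j p) = (if i = j then 1 else 0)"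
    using b unfolding orthonormal_basis_def by blast+
qed

text \<open>A combination of a local adapted frame with constant coefficients is an
  extension.\<close>

lemma extend_tangent:
  assumes "v \<in> tangent A p"
  shows "\<exists>X. vfield_near A p X \<and> X p = v"
proof -
  obtain U e where e: "p \<in> U" "adapted_frame_on A g \<xi> \<phi> U e" using frames by blast
  let ?X = "\<lambda>q f. \<Sum>i\<in>UNIV. g p (e i p) v * e i q f"
  have "?X p = v"
    using orthonormal_expansion[OF frame_orthonormal[OF e(2,1)] assms] by simp
  moreover have "vfield_near A p ?X"
    using e by (intro vfield_near_sum frame_near) auto
  ultimately show ?thesis by blast
qed

lemma ex_orthonormal: "\<exists>b. orthonormal_basis A g p b"
  using frames frame_orthonormal by blast

text \<open>The arbitrary extension \<open>W\<close> disappears: differentiating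
  \<open>\<eta>(W)\<close> by the metric rule produces the term with the derivative of
  \<open>W\<close>, which is exactly the one subtracted.\<close>

lemma nabla_eta:
  assumes D: "metric_connection A g D" and v: "v \<in> tangent A p" and w: "w \<in> tangent A p"
  shows "nabla_oneform A D \<eta> p v w = g p (D p v \<xi>) w"
proof -
  define W where "W = (SOME W. vfield_near A p W \<and> W p = w)"
  have W: "vfield_near A p W" "W p = w"
    using someI_ex[OF extend_tangent[OF w]] by (auto simp: W_def)
  obtain U where U: "p \<in> U" "vfield_on A U W" using W by (auto simp: vfield_near_def)
  have "v (\<lambda>q. \<eta> q (W q)) = v (\<lambda>q. g q (\<xi> q) (W q))"
    using U by (intro tangent_cong[OF v, of U]) (auto simp: vfield_on_def eta_eq)
  then show ?thesis
    using metric_rule[OF D xi_near W(1) v] W(2) connection_tangent[OF metric_connectionD[OF D] v W(1)]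
    by (simp add: nabla_oneform_def W_def[symmetric] eta_eq)
qed

lemma Dg_xi_tangent: "v \<in> tangent A p \<Longrightarrow> Dg p v \<xi> \<in> tangent A p"
  by (rule connection_tangent[OF connection_Dg _ xi_near])

lemma Dg_xi_lincomb_left:
  assumes "v \<in> tangent A p" "w \<in> tangent A p" "z \<in> tangent A p"
  shows "g p (Dg p (lincomb a v b w) \<xi>) z = a * g p (Dg p v \<xi>) z + b * g p (Dg p w \<xi>) z"
  using assms
  by (simp add: connection_lincomb[OF connection_Dg] xi_near g_lincomb_left Dg_xi_tangent)

text \<open>Each of the two sums over the chosen basis is the expansion of a linear function, so the
  choice drops out.\<close>

lemma ext_deriv_eta:
  assumes v: "v \<in> tangent A p" and w: "w \<in> tangent A p"
  shows "ext_deriv A g Dg \<eta> p v w = g p (Dg p v \<xi>) w - g p (Dg p w \<xi>) v"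
proof -
  define b where "b = (SOME b. orthonormal_basis A g p b)"
  have b: "orthonormal_basis A g p b" unfolding b_def using ex_orthonormal by (rule someI_ex)
  then have t: "b i \<in> tangent A p" for i by (simp add: orthonormal_basis_def)
  have "ext_deriv A g Dg \<eta> p v w =
      (\<Sum>i\<in>UNIV. g p (b i) v * g p (Dg p (b i) \<xi>) w) - (\<Sum>i\<in>UNIV. g p (b i) w * g p (Dg p (b i) \<xi>) v)"
    by (simp add: ext_deriv_def b_def[symmetric] nabla_eta[OF metric_connection_Dg] t v w sum_subtractf)
  also have "(\<Sum>i\<in>UNIV. g p (b i) v * g p (Dg p (b i) \<xi>) w) = g p (Dg p v \<xi>) w"
    by (rule linear_expansion[OF b v, symmetric]) (simp add: Dg_xi_lincomb_left w)
  also have "(\<Sum>i\<in>UNIV. g p (b i) w * g p (Dg p (b i) \<xi>) v) = g p (Dg p w \<xi>) v"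
    by (rule linear_expansion[OF b w, symmetric]) (simp add: Dg_xi_lincomb_left v)
  finally show ?thesis .
qed

text \<open>
  The second condition is the \<open>\<xi>\<close>-component of \<open>\<nabla>\<^sup>g - \<theta>\<^sub>1(L)\<close> preserving the structure.
\<close>
definition Lee_form :: "'m \<Rightarrow> ('m tvec \<Rightarrow> real) \<Rightarrow> bool" where
  "Lee_form p L \<longleftrightarrow>
     (\<forall>v\<in>tangent A p. \<forall>w\<in>tangent A p. \<forall>a b. L (lincomb a v b w) = a * L v + b * L w) \<and>
     (\<forall>v\<in>tangent A p. \<forall>z\<in>tangent A p. g p (Dg p v \<xi>) z = L z * \<eta> p v - L (\<xi> p) * g p v z)"

text \<open>The 1-form of the theorem, not the connection forms; putting \<open>\<xi>\<close> into
  the first slot is the interior product.\<close>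

definition omega :: "'m oneform" where
  "omega p v = 1/4 * codiff A g Dg \<eta> p * \<eta> p v + ext_deriv A g Dg \<eta> p (\<xi> p) v"

section \<open>Trace, skew part and uniqueness of a Lee form\<close>

context
  fixes p :: 'm and L :: "'m tvec \<Rightarrow> real"
  assumes Lee: "Lee_form p L"
begin

lemma Lee_linear: "v \<in> tangent A p \<Longrightarrow> w \<in> tangent A p \<Longrightarrow> L (lincomb a v b w) = a * L v + b * L w"
  and Lee_nabla: "v \<in> tangent A p \<Longrightarrow> z \<in> tangent A p \<Longrightarrow>
    g p (Dg p v \<xi>) z = L z * \<eta> p v - L (\<xi> p) * g p v z"
  using Lee unfolding Lee_form_def by blast+

text \<open>Trace of the Lee equation: its first term contributes \<open>L (\<xi> p)\<close>, the
  metric term five times that amount with a minus sign.\<close>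

lemma codiff_Lee: "codiff A g Dg \<eta> p = 4 * L (\<xi> p)"
proof -
  define b where "b = (SOME b. orthonormal_basis A g p b)"
  have b: "orthonormal_basis A g p b" unfolding b_def using ex_orthonormal by (rule someI_ex)
  then have t: "b i \<in> tangent A p" and n: "g p (b i) (b i) = 1" for i
    by (simp_all add: orthonormal_basis_def)
  have "codiff A g Dg \<eta> p = - (\<Sum>i\<in>UNIV. g p (b i) (\<xi> p) * L (b i) - L (\<xi> p))"
    by (simp add: codiff_def b_def[symmetric] nabla_eta[OF metric_connection_Dg] t n Lee_nabla
        eta_eq g_sym[OF _ xi_tangent] mult.commute)
  also have "(\<Sum>i\<in>UNIV. g p (b i) (\<xi> p) * L (b i) - L (\<xi> p)) = L (\<xi> p) - 5 * L (\<xi> p)"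
    using linear_expansion[OF b xi_tangent, of L] Lee_linear by (simp add: sum_subtractf)
  finally show ?thesis by simp
qed

lemma ext_deriv_Lee:
  "v \<in> tangent A p \<Longrightarrow> w \<in> tangent A p \<Longrightarrow>
    ext_deriv A g Dg \<eta> p v w = \<eta> p v * L w - \<eta> p w * L v"
  by (simp add: ext_deriv_eta Lee_nabla g_sym[of w p v] mult.commute)

text \<open>The exterior derivative gives \<open>L v\<close> minus
  \<open>L (\<xi> p) * \<eta> p v\<close>, and the codifferential term restores the loss. Hence a
  Lee form is unique on tangent vectors.\<close>

lemma omega_Lee: "v \<in> tangent A p \<Longrightarrow> omega p v = L v"
  by (simp add: omega_def codiff_Lee ext_deriv_Lee xi_tangent eta_xi)

end

text \<open>Despite the name these are the components of the full Levi-Civita form; applying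
  \<open>pr_W\<close> yields \<open>intrinsic_torsion\<close>.\<close>

definition frame_torsion :: "(5 \<Rightarrow> 'm vfield) \<Rightarrow> 'm \<Rightarrow> tensor3" where
  "frame_torsion e p = (\<chi> i j k. g p (Dg p (e i p) (e j)) (e k p))"

text \<open>Differentiate the constant functions \<open>g q (e j q) (e k q)\<close> with the metric
  rule.\<close>

lemma frame_torsion_Lambda2:
  assumes e: "adapted_frame_on A g \<xi> \<phi> U e" and p: "p \<in> U"
  shows "frame_torsion e p $ i \<in> Lambda2"
proof -
  have "g p (Dg p (e i p) (e j)) (e k p) = - g p (Dg p (e i p) (e k)) (e j p)" for j k
  proof -
    note t = frame_tangent[OF e p, of i]
    have "e i p (\<lambda>q. g q (e j q) (e k q)) = e i p (\<lambda>_. if j = k then 1 else 0)"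
      by (rule tangent_cong[OF t frame_open[OF e] p]) (simp add: frame_g[OF e])
    then have "g p (Dg p (e i p) (e j)) (e k p) + g p (e j p) (Dg p (e i p) (e k)) = 0"
      using metric_rule[OF metric_connection_Dg frame_near[OF e p] frame_near[OF e p] t, of j k]
        tangent_const[OF t] by simp
    then show ?thesis
      using g_sym[OF frame_tangent[OF e p] connection_tangent[OF connection_Dg t frame_near[OF e p]]]
      by (simp add: add_eq_0_iff2)
  qed
  then show ?thesis unfolding Lambda2_def frame_torsion_def mem_Collect_eq vec_lambda_beta by (intro allI)
qed

lemma of_class_iff:
  "of_class A g \<xi> \<phi> Dg ((pr_W \<circ> theta0) ` S) \<longleftrightarrow>
    (\<forall>p. \<exists>U e. p \<in> U \<and> adapted_frame_on A g \<xi> \<phi> U e \<and>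
      (\<exists>a\<in>S. \<forall>i. frame_torsion e p $ i - theta0 a $ i \<in> u2_forms))"
  unfolding of_class_def intrinsic_torsion_def frame_torsion_def[symmetric]
  using pr_W_mem_iff[OF frame_torsion_Lambda2] by meson

text \<open>Row 5 of an element of u(2) vanishes, which determines the derivative of
  \<open>e 5 = \<xi>\<close> on frame vectors (\<open>F1\<close>). Linearity extends this first in
  the direction of differentiation (\<open>F2\<close>) and then in the test vector.\<close>

lemma frame_Lee:
  assumes e: "adapted_frame_on A g \<xi> \<phi> U e" and p: "p \<in> U"
    and a: "\<And>i. frame_torsion e p $ i - theta0 a $ i \<in> u2_forms"
  defines "L \<equiv> \<lambda>v. \<Sum>k\<in>UNIV. a $ k * g p (e k p) v"
  shows "Lee_form p L" "L (e k p) = a $ k" "L (\<xi> p) = a $ 5"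
proof -
  note t = frame_tangent[OF e p] and b = frame_orthonormal[OF e p]
  show Le: "L (e k p) = a $ k" for k
    unfolding L_def frame_g[OF e p] by (simp add: if_distrib[of "(*) _"] cong: if_cong)
  then show L5: "L (\<xi> p) = a $ 5" using frame_5[OF e p] by metis
  have L: "L (lincomb x v y w) = x * L v + y * L w" if "v \<in> tangent A p" "w \<in> tangent A p" for v w x y
    unfolding L_def using that t
    by (simp add: g_lincomb_right sum.distrib[symmetric] sum_distrib_left algebra_simps)
  have F1: "g p (Dg p (e i p) \<xi>) (e k p) = L (e k p) * \<eta> p (e i p) - L (\<xi> p) * g p (e i p) (e k p)" for i k
  proof -
    \<comment> \<open>The fields \<open>e 5\<close> and \<open>\<xi>\<close> agree on
      \<open>U\<close> only, so locality is used.\<close>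
    have "Dg p (e i p) (e 5) = Dg p (e i p) \<xi>"
      by (rule connection_cong[OF connection_Dg t frame_near[OF e p] frame_open[OF e] p]) (rule frame_5[OF e])
    moreover have "frame_torsion e p $ i $ 5 $ k = theta0 a $ i $ 5 $ k"
      using a[of i] by (simp add: u2_forms_def)
    moreover have "\<eta> p (e i p) = (if 5 = i then 1 else 0)"
      using frame_g[OF e p, of 5 i] frame_5[OF e p] t by (simp add: eta_eq)
    ultimately show ?thesis
      by (auto simp: frame_torsion_def theta0_def Le L5 frame_g[OF e p] mat_def)
  qed
  have F2: "g p (Dg p v \<xi>) (e k p) = L (e k p) * \<eta> p v - L (\<xi> p) * g p v (e k p)"
    if "v \<in> tangent A p" for k v
    by (rule linear_eq_on_basis[OF b that, where L = "\<lambda>v. g p (Dg p v \<xi>) (e k p)"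
          and M = "\<lambda>v. L (e k p) * \<eta> p v - L (\<xi> p) * g p v (e k p)"])
      (simp_all add: F1 Dg_xi_lincomb_left t eta_lincomb g_lincomb_left algebra_simps)
  have "g p (Dg p v \<xi>) z = L z * \<eta> p v - L (\<xi> p) * g p v z"
    if "v \<in> tangent A p" "z \<in> tangent A p" for z v
    by (rule linear_eq_on_basis[OF b that(2), where L = "\<lambda>z. g p (Dg p v \<xi>) z"
          and M = "\<lambda>z. L z * \<eta> p v - L (\<xi> p) * g p v z"])
      (simp_all add: F2 that Dg_xi_tangent L g_lincomb_right algebra_simps)
  then show "Lee_form p L" using L by (simp add: Lee_form_def)
qed

section \<open>The connection with vectorial torsion\<close>

text \<open>Koszul's argument: a metric connection is determined by its torsion.\<close>
lemma vectorial_difference: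
  assumes D: "metric_connection A g D"
    and tor: "\<And>X Y z. vfield_near A p X \<Longrightarrow> vfield_near A p Y \<Longrightarrow> z \<in> tangent A p \<Longrightarrow>
        g p (torsion A D X Y p) z = \<alpha> (X p) * g p (Y p) z - \<alpha> (Y p) * g p (X p) z"
    and v: "v \<in> tangent A p" and Y: "vfield_near A p Y" and z: "z \<in> tangent A p"
  shows "g p (D p v Y) z = g p (Dg p v Y) z + \<alpha> z * g p v (Y p) - \<alpha> (Y p) * g p v z"
proof -
  obtain X where X: "vfield_near A p X" "X p = v" using extend_tangent[OF v] by blast
  obtain Z where Z: "vfield_near A p Z" "Z p = z" using extend_tangent[OF z] by blast
  note near = X(1) Y Z(1)
  note cD = metric_connectionD[OF D]
  \<comment> \<open>The difference tensor of the two connections. It is skew in its last two slots,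
    and its skew part in the first two is the torsion of \<open>D\<close>.\<close>
  define N where "N X Y Z = g p (D p (X p) Y) (Z p) - g p (Dg p (X p) Y) (Z p)" for X Y Z
  have skew: "N P Q R = - N P R Q" if "vfield_near A p P" "vfield_near A p Q" "vfield_near A p R" for P Q R
  proof -
    note t = that[THEN vfield_near_tangent]
    show ?thesis
      using metric_rule[OF D that(2,3) t(1)] metric_rule[OF metric_connection_Dg that(2,3) t(1)]
        g_sym[OF t(2) connection_tangent[OF cD t(1) that(3)]]
        g_sym[OF t(2) connection_tangent[OF connection_Dg t(1) that(3)]]
      by (simp add: N_def)
  qed
  have tors: "N P Q R - N Q P R = \<alpha> (P p) * g p (Q p) (R p) - \<alpha> (Q p) * g p (P p) (R p)"
    if "vfield_near A p P" "vfield_near A p Q" "vfield_near A p R" for P Q R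
  proof -
    note t = that[THEN vfield_near_tangent]
    note [simp] = t connection_tangent[OF cD t(1) that(2)] connection_tangent[OF cD t(2) that(1)]
      connection_tangent[OF connection_Dg t(1) that(2)] connection_tangent[OF connection_Dg t(2) that(1)]
    have "torsion A Dg P Q p = (\<lambda>_. 0)" using lc that unfolding levi_civita_def by blast
    \<comment> \<open>Subtracting the vanishing torsion of \<open>Dg\<close> removes the
      bracket.\<close>
    then have "torsion A D P Q p = (\<lambda>f. torsion A D P Q p f - torsion A Dg P Q p f)" by simp
    also have "\<dots> = lincomb 1 (lincomb 1 (D p (P p) Q) (- 1) (Dg p (P p) Q))
        (- 1) (lincomb 1 (D p (Q p) P) (- 1) (Dg p (Q p) P))"
      by (simp add: torsion_def lincomb_def fun_eq_iff)
    finally have "g p (torsion A D P Q p) (R p) = N P Q R - N Q P R"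
      by (simp add: g_lincomb_left tangent_lincomb N_def)
    then show ?thesis using tor[OF that(1,2) t(3)] by simp
  qed
  note t = near[THEN vfield_near_tangent]
  \<comment> \<open>The cyclic torsion identities with alternating signs, rewritten by skewness,
    leave twice \<open>N X Y Z\<close>.\<close>
  have "N X Y Z = \<alpha> (Z p) * g p (X p) (Y p) - \<alpha> (Y p) * g p (X p) (Z p)"
    using skew[OF near] skew[OF near(2,3,1)] skew[OF near(3,1,2)]
      tors[OF near] tors[OF near(2,3,1)] tors[OF near(3,1,2)]
      g_sym[OF t(1,2)] g_sym[OF t(2,3)] g_sym[OF t(3,1)]
    by simp
  then show ?thesis using X Z by (simp add: N_def)
qed

text \<open>Inserting \<open>\<xi>\<close> into \<open>vectorial_difference\<close> shows that minus
  the torsion form is a Lee form, and \<open>omega_Lee\<close> identifies it. This gives the formula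
  of the theorem and also drives uniqueness.\<close>

lemma compatible_vectorial:
  assumes D: "metric_connection A g D" and vt: "vectorial_torsion A g D"
    and comp: "compatible A \<xi> \<eta> \<phi> D"
    and x: "x \<in> tangent A p" and Y: "vfield_near A p Y" and z: "z \<in> tangent A p"
  shows "g p (D p x Y) z = g p (Dg p x Y) z - theta1 g omega p x (Y p) z"
proof -
  obtain \<alpha> where \<alpha>: "smooth_oneform A \<alpha>"
    and tor: "\<And>p X Y z. vfield_near A p X \<Longrightarrow> vfield_near A p Y \<Longrightarrow> z \<in> tangent A p \<Longrightarrow>
        g p (torsion A D X Y p) z = \<alpha> p (X p) * g p (Y p) z - \<alpha> p (Y p) * g p (X p) z"
    using vt unfolding vectorial_torsion_def by blast
  have diff: "g p (D p v Y) z = g p (Dg p v Y) z + \<alpha> p z * g p v (Y p) - \<alpha> p (Y p) * g p v z"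
    if "v \<in> tangent A p" "vfield_near A p Y" "z \<in> tangent A p" for v Y z
    by (rule vectorial_difference[where \<alpha> = "\<alpha> p", OF D _ that]) (rule tor)
  have "Lee_form p (\<lambda>v. - \<alpha> p v)"
    unfolding Lee_form_def
  proof (intro conjI ballI allI)
    fix v w a b assume "v \<in> tangent A p" "w \<in> tangent A p"
    then have "\<alpha> p (lincomb a v b w) = a * \<alpha> p v + b * \<alpha> p w"
      using \<alpha> unfolding smooth_oneform_def by blast
    then show "- \<alpha> p (lincomb a v b w) = a * - \<alpha> p v + b * - \<alpha> p w" by simp
  next
    fix v z assume v: "v \<in> tangent A p" and z: "z \<in> tangent A p"
    have "D p v \<xi> = (\<lambda>_. 0)" using comp v unfolding compatible_def by blast
    then have "g p (D p v \<xi>) z = 0" by (simp add: g_zero[OF z])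
    then show "g p (Dg p v \<xi>) z = - \<alpha> p z * \<eta> p v - - \<alpha> p (\<xi> p) * g p v z"
      using diff[OF v xi_near z] by (simp add: eta_eq[OF v] g_sym[OF v xi_tangent])
  qed
  from omega_Lee[OF this] have "omega p z = - \<alpha> p z" "omega p (Y p) = - \<alpha> p (Y p)"
    using z vfield_near_tangent[OF Y] by auto
  then show ?thesis using diff[OF x Y z] by (simp add: theta1_def)
qed

section \<open>Consequences of the class condition\<close>

context
  assumes cls: "of_class A g \<xi> \<phi> Dg W1_plus_W2"
begin

lemma class_frame:
  obtains U e a where "p \<in> U" "adapted_frame_on A g \<xi> \<phi> U e"
    "\<And>i. frame_torsion e p $ i - theta0 a $ i \<in> u2_forms"
  using cls unfolding W1_plus_W2_eq of_class_iff by meson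

lemma ex_Lee: "\<exists>L. Lee_form p L"
proof -
  obtain U e a where "p \<in> U" "adapted_frame_on A g \<xi> \<phi> U e"
    "\<And>i. frame_torsion e p $ i - theta0 a $ i \<in> u2_forms" by (rule class_frame[of p]) (rule that)
  from frame_Lee(1)[OF this(2,1,3)] show ?thesis by blast
qed

text \<open>The form found in a frame at \<open>p\<close> agrees with \<open>omega p\<close> on
  tangent vectors, so the Lee equation passes to a globally defined form.\<close>

lemma Lee_omega: "Lee_form p (omega p)"
proof -
  obtain L where L: "Lee_form p L" using ex_Lee by blast
  show ?thesis
    unfolding Lee_form_def
    by (simp add: omega_Lee[OF L] tangent_lincomb xi_tangent Lee_linear[OF L] Lee_nabla[OF L])
qed

text \<open>Forwards, \<open>L\<close> is a multiple of \<open>\<eta>\<close>, so the wedge product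
  in \<open>ext_deriv_Lee\<close> vanishes. Backwards, evaluating at \<open>\<xi>\<close> and
  \<open>e k\<close> recovers \<open>a $ k\<close> for \<open>k\<close> other than 5, so the frame
  given by the larger class already serves.\<close>

lemma of_class_W1_iff:
  "of_class A g \<xi> \<phi> Dg W1 \<longleftrightarrow>
    (\<forall>p. \<forall>v\<in>tangent A p. \<forall>w\<in>tangent A p. ext_deriv A g Dg \<eta> p v w = 0)"
proof (intro iffI allI ballI)
  fix p v w
  assume "of_class A g \<xi> \<phi> Dg W1" and vw: "v \<in> tangent A p" "w \<in> tangent A p"
  then obtain U e a where e: "p \<in> U" "adapted_frame_on A g \<xi> \<phi> U e" "a \<in> Lambda1_1"
    "\<And>i. frame_torsion e p $ i - theta0 a $ i \<in> u2_forms"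
    unfolding W1_eq of_class_iff by meson
  define L where "L v = (\<Sum>k\<in>UNIV. a $ k * g p (e k p) v)" for v
  have L: "Lee_form p L" using frame_Lee(1)[OF e(2,1,4)] by (simp add: L_def[abs_def])
  have "L v = a $ 5 * \<eta> p v" if "v \<in> tangent A p" for v
    using e(3) frame_5[OF e(2,1)] that by (simp add: L_def sum_5 Lambda1_1_iff eta_eq)
  then show "ext_deriv A g Dg \<eta> p v w = 0"
    by (simp add: ext_deriv_Lee[OF L] vw)
next
  assume d: "\<forall>p. \<forall>v\<in>tangent A p. \<forall>w\<in>tangent A p. ext_deriv A g Dg \<eta> p v w = 0"
  show "of_class A g \<xi> \<phi> Dg W1"
    unfolding W1_eq of_class_iff
  proof
    fix p
    obtain U e a where e: "p \<in> U" "adapted_frame_on A g \<xi> \<phi> U e"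
      "\<And>i. frame_torsion e p $ i - theta0 a $ i \<in> u2_forms" by (rule class_frame[of p]) (rule that)
    note t = frame_tangent[OF e(2,1)]
    note L = frame_Lee[OF e(2,1,3)]
    have "a $ k = 0" if "k \<noteq> 5" for k
    proof -
      have "\<eta> p (e k p) = 0"
        using that frame_g[OF e(2,1), of 5 k] frame_5[OF e(2,1)] t by (simp add: eta_eq)
      then have "ext_deriv A g Dg \<eta> p (\<xi> p) (e k p) = a $ k"
        using ext_deriv_Lee[OF L(1) xi_tangent t, of k] L(2)[of k] by (simp add: eta_xi)
      then show ?thesis using d xi_tangent t by simp
    qed
    then have "a \<in> Lambda1_1" by (simp add: Lambda1_1_iff)
    then show "\<exists>U e. p \<in> U \<and> adapted_frame_on A g \<xi> \<phi> U e \<and>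
        (\<exists>a\<in>Lambda1_1. \<forall>i. frame_torsion e p $ i - theta0 a $ i \<in> u2_forms)"
      using e by blast
  qed
qed

text \<open>Both directions rest on the codifferential being four times
  \<open>a $ 5\<close>.\<close>

lemma of_class_W2_iff: "of_class A g \<xi> \<phi> Dg W2 \<longleftrightarrow> (\<forall>p. codiff A g Dg \<eta> p = 0)"
proof (intro iffI allI)
  fix p
  assume "of_class A g \<xi> \<phi> Dg W2"
  then obtain U e a where e: "p \<in> U" "adapted_frame_on A g \<xi> \<phi> U e" "a \<in> Lambda1_2"
    "\<And>i. frame_torsion e p $ i - theta0 a $ i \<in> u2_forms"
    unfolding W2_def of_class_iff by meson
  show "codiff A g Dg \<eta> p = 0"
    using codiff_Lee[OF frame_Lee(1)[OF e(2,1,4)]] frame_Lee(3)[OF e(2,1,4)] e(3)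
    by (simp add: Lambda1_2_def)
next
  assume d: "\<forall>p. codiff A g Dg \<eta> p = 0"
  show "of_class A g \<xi> \<phi> Dg W2"
    unfolding W2_def of_class_iff
  proof
    fix p
    obtain U e a where e: "p \<in> U" "adapted_frame_on A g \<xi> \<phi> U e"
      "\<And>i. frame_torsion e p $ i - theta0 a $ i \<in> u2_forms" by (rule class_frame[of p]) (rule that)
    have "a \<in> Lambda1_2"
      using codiff_Lee[OF frame_Lee(1)[OF e(2,1,3)]] frame_Lee(3)[OF e(2,1,3)] d
      by (simp add: Lambda1_2_def)
    then show "\<exists>U e. p \<in> U \<and> adapted_frame_on A g \<xi> \<phi> U e \<and>
        (\<exists>a\<in>Lambda1_2. \<forall>i. frame_torsion e p $ i - theta0 a $ i \<in> u2_forms)"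
      using e by blast
  qed
qed

section \<open>Construction of the connection\<close>

lemmas omega_lincomb = Lee_linear[OF Lee_omega]
  and Dg_xi = Lee_nabla[OF Lee_omega]

text \<open>The metric dual of \<open>omega\<close>, written through the derivative of
  \<open>\<xi>\<close> along itself so that its smoothness follows from that of the
  connection.\<close>

definition Lee_field :: "'m vfield" where
  "Lee_field p = lincomb 1 (Dg p (\<xi> p) \<xi>) (codiff A g Dg \<eta> p / 4) (\<xi> p)"

text \<open>The definition of \<open>codiff\<close> chooses a basis at each point and shows no
  smoothness. By the Lee equation any unit vector orthogonal to \<open>\<xi>\<close> computes a
  quarter of it, and the first frame field does so smoothly.\<close>

lemma smooth_codiff: "smooth_fun_on A UNIV (\<lambda>p. codiff A g Dg \<eta> p / 4)"
proof (rule smooth_fun_on_local)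
  fix p :: 'm
  obtain U e where e: "p \<in> U" "adapted_frame_on A g \<xi> \<phi> U e" using frames by blast
  note U = frame_open[OF e(2)] and e1 = frame_smooth[OF e(2), of 1]
  have "smooth_fun_on A U (\<lambda>q. (- 1) * g q (Dg q (e 1 q) \<xi>) (e 1 q))"
    using U e1 by (intro smooth_fun_on_mult smooth_fun_on_const g_smooth connection_smooth[OF connection_Dg]
        vfield_on_subset[OF xi_smooth]) auto
  moreover have "(- 1) * g q (Dg q (e 1 q) \<xi>) (e 1 q) = codiff A g Dg \<eta> q / 4" if q: "q \<in> U" for q
  proof -
    note t = frame_tangent[OF e(2) q]
    have "\<eta> q (e 1 q) = 0"
      using frame_g[OF e(2) q, of 5 1] frame_5[OF e(2) q] t by (simp add: eta_eq)
    then show ?thesis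
      using Dg_xi[OF t t, of 1 1] frame_g[OF e(2) q, of 1 1] codiff_Lee[OF Lee_omega, of q] by simp
  qed
  ultimately have "smooth_fun_on A U (\<lambda>p. codiff A g Dg \<eta> p / 4)" by (rule smooth_fun_on_cong)
  then show "\<exists>V. p \<in> V \<and> smooth_fun_on A V (\<lambda>p. codiff A g Dg \<eta> p / 4)" using e(1) by blast
qed simp

lemma Lee_field_smooth: "vfield_on A UNIV Lee_field"
  unfolding Lee_field_def[abs_def]
  by (intro vfield_on_lincomb smooth_codiff smooth_fun_on_const xi_smooth
      connection_smooth[OF connection_Dg]) simp

lemma Lee_field_tangent: "Lee_field p \<in> tangent A p"
  using Lee_field_smooth by (simp add: vfield_on_def)

lemma omega_eq: "v \<in> tangent A p \<Longrightarrow> omega p v = g p (Lee_field p) v"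
  by (simp add: Lee_field_def g_lincomb_left Dg_xi_tangent xi_tangent Dg_xi eta_xi
      codiff_Lee[OF Lee_omega] eta_eq)

lemma omega_smooth: "vfield_on A U X \<Longrightarrow> smooth_fun_on A U (\<lambda>q. omega q (X q))"
proof -
  assume X: "vfield_on A U X"
  then have "vfield_on A U Lee_field" by (intro vfield_on_subset[OF Lee_field_smooth]) (auto simp: vfield_on_def)
  then have "smooth_fun_on A U (\<lambda>q. g q (Lee_field q) (X q))" using X by (rule g_smooth)
  then show ?thesis
    by (rule smooth_fun_on_cong) (use X in \<open>simp add: omega_eq vfield_on_def\<close>)
qed

text \<open>The formula of the theorem solved for the vector, with \<open>Lee_field\<close> dual to
  \<open>omega\<close>. The default value is the one required by \<open>connection\<close>.\<close>

definition nabla_c :: "'m conn" where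
  "nabla_c p v Y = (if v \<in> tangent A p \<and> vfield_near A p Y
     then lincomb 1 (lincomb 1 (Dg p v Y) (omega p (Y p)) v) (- g p v (Y p)) (Lee_field p)
     else (\<lambda>_. 0))"

lemma nabla_c_tangent:
  "v \<in> tangent A p \<Longrightarrow> vfield_near A p Y \<Longrightarrow> nabla_c p v Y \<in> tangent A p"
  by (simp add: nabla_c_def tangent_lincomb connection_tangent[OF connection_Dg] Lee_field_tangent)

lemma g_nabla_c:
  assumes "v \<in> tangent A p" "vfield_near A p Y" "z \<in> tangent A p"
  shows "g p (nabla_c p v Y) z = g p (Dg p v Y) z + omega p (Y p) * g p v z - g p v (Y p) * omega p z"
  using assms
  by (simp add: nabla_c_def g_lincomb_left tangent_lincomb connection_tangent[OF connection_Dg]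
      Lee_field_tangent omega_eq)

text \<open>The terms added to \<open>Dg\<close> are tensorial in \<open>v\<close> and
  \<open>Y\<close>, so linearity and the Leibniz rule are inherited.\<close>

lemma connection_nabla_c: "connection A nabla_c"
  unfolding connection_def
proof (intro conjI allI impI ballI)
  show "nabla_c p v Y \<in> tangent A p" if "v \<in> tangent A p \<and> vfield_near A p Y" for p v Y
    using that by (simp add: nabla_c_tangent)
  show "nabla_c p v Y = (\<lambda>_. 0)" if "\<not> (v \<in> tangent A p \<and> vfield_near A p Y)" for p v Y
    unfolding nabla_c_def using that by (rule if_not_P)
  show "nabla_c p (lincomb a v b w) Y = lincomb a (nabla_c p v Y) b (nabla_c p w Y)"
    if Y: "vfield_near A p Y" and v: "v \<in> tangent A p" and w: "w \<in> tangent A p" for p Y v w a b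
  proof -
    have "nabla_c p (lincomb a v b w) Y f = lincomb a (nabla_c p v Y) b (nabla_c p w Y) f" for f
      using connection_lincomb[OF connection_Dg Y v w]
      by (simp add: nabla_c_def Y v w tangent_lincomb g_lincomb_left vfield_near_tangent[OF Y])
        (simp add: lincomb_def algebra_simps)
    then show ?thesis by blast
  qed
  show "nabla_c p v (\<lambda>q. lincomb 1 (Y q) 1 (Z q)) = lincomb 1 (nabla_c p v Y) 1 (nabla_c p v Z)"
    if Y: "vfield_near A p Y" and Z: "vfield_near A p Z" and v: "v \<in> tangent A p" for p Y Z v
  proof -
    note t = vfield_near_tangent[OF Y] vfield_near_tangent[OF Z]
    have YZ: "vfield_near A p (\<lambda>q. lincomb 1 (Y q) 1 (Z q))"
      using Y Z smooth_near_const smooth_near_const by (rule vfield_near_lincomb)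
    have "nabla_c p v (\<lambda>q. lincomb 1 (Y q) 1 (Z q)) f = lincomb 1 (nabla_c p v Y) 1 (nabla_c p v Z) f" for f
      using connection_add[OF connection_Dg Y Z v]
      by (simp add: nabla_c_def Y Z YZ v g_lincomb_right omega_lincomb t)
        (simp add: lincomb_def algebra_simps)
    then show ?thesis by blast
  qed
  show "nabla_c p v (\<lambda>q h. f q * Y q h) = lincomb (f p) (nabla_c p v Y) (v f) (Y p)"
    if f: "smooth_near A p f" and Y: "vfield_near A p Y" and v: "v \<in> tangent A p" for p f Y v
  proof -
    note t = vfield_near_tangent[OF Y]
    have "omega p (\<lambda>h. f p * Y p h) = f p * omega p (Y p)"
      "g p v (\<lambda>h. f p * Y p h) = f p * g p v (Y p)"
      using omega_lincomb[OF t t, of "f p" 0] g_lincomb_right[OF t t v, of "f p" 0]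
      by (simp_all add: lincomb_def)
    then have "nabla_c p v (\<lambda>q h. f q * Y q h) k = lincomb (f p) (nabla_c p v Y) (v f) (Y p) k" for k
      using connection_scale[OF connection_Dg f Y v]
      by (simp add: nabla_c_def Y v vfield_near_scale[OF Y f]) (simp add: lincomb_def algebra_simps)
    then show ?thesis by blast
  qed
  show "vfield_on A U (\<lambda>q. nabla_c q (X q) Y)" if X: "vfield_on A U X" and Y: "vfield_on A U Y" for U X Y
  proof -
    have U: "open U" using X by (simp add: vfield_on_def)
    have "smooth_fun_on A U (\<lambda>q. (- 1) * g q (X q) (Y q))"
      using U X Y by (intro smooth_fun_on_mult smooth_fun_on_const g_smooth)
    then have "vfield_on A U (\<lambda>q. lincomb 1 (lincomb 1 (Dg q (X q) Y) (omega q (Y q)) (X q))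
        ((- 1) * g q (X q) (Y q)) (Lee_field q))"
      using U X Y by (intro vfield_on_lincomb smooth_fun_on_const omega_smooth
          vfield_on_subset[OF Lee_field_smooth] connection_smooth[OF connection_Dg]) auto
    then show ?thesis
    proof (rule vfield_on_cong)
      fix q assume "q \<in> U"
      then have "X q \<in> tangent A q" "vfield_near A q Y"
        using X Y by (auto simp: vfield_on_def vfield_near_def)
      then show "lincomb 1 (lincomb 1 (Dg q (X q) Y) (omega q (Y q)) (X q))
          ((- 1) * g q (X q) (Y q)) (Lee_field q) = nabla_c q (X q) Y"
        by (simp add: nabla_c_def)
    qed
  qed
qed

text \<open>The added terms are skew in \<open>Y\<close> and \<open>Z\<close> and cancel in the
  metric rule.\<close>

lemma metric_nabla_c: "metric_connection A g nabla_c"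
  unfolding metric_connection_def
proof (intro conjI connection_nabla_c allI impI ballI)
  fix p Y Z v assume Y: "vfield_near A p Y" and Z: "vfield_near A p Z" and v: "v \<in> tangent A p"
  note t = vfield_near_tangent[OF Y] vfield_near_tangent[OF Z]
  have "g p (Y p) (nabla_c p v Z) = g p (nabla_c p v Z) (Y p)"
    "g p (Y p) (Dg p v Z) = g p (Dg p v Z) (Y p)"
    using g_sym[OF t(1)] nabla_c_tangent[OF v Z] connection_tangent[OF connection_Dg v Z] by auto
  then show "v (\<lambda>q. g q (Y q) (Z q)) = g p (nabla_c p v Y) (Z p) + g p (Y p) (nabla_c p v Z)"
    using metric_rule[OF metric_connection_Dg Y Z v]
    by (simp add: g_nabla_c v Y Z t algebra_simps)
qed

lemma vectorial_nabla_c: "vectorial_torsion A g nabla_c"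
  unfolding vectorial_torsion_def
proof (intro exI conjI allI impI ballI)
  \<comment> \<open>The torsion form is minus \<open>omega\<close>, since \<open>theta1\<close> is
    subtracted in the theorem.\<close>
  show "smooth_oneform A (\<lambda>p v. (- 1) * omega p v)"
    unfolding smooth_oneform_def
  proof (intro conjI allI impI ballI)
    fix U X assume X: "vfield_on A U X"
    then have "open U" by (simp add: vfield_on_def)
    then show "smooth_fun_on A U (\<lambda>q. (- 1) * omega q (X q))"
      by (intro smooth_fun_on_mult smooth_fun_on_const omega_smooth X)
  qed (simp add: omega_lincomb algebra_simps)
  fix p X Y z
  assume X: "vfield_near A p X" and Y: "vfield_near A p Y" and z: "z \<in> tangent A p"
  note t = vfield_near_tangent[OF X] vfield_near_tangent[OF Y]
  have "torsion A Dg X Y p = (\<lambda>_. 0)" using lc X Y unfolding levi_civita_def by blast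
  then have "torsion A nabla_c X Y p = (\<lambda>f. torsion A nabla_c X Y p f - torsion A Dg X Y p f)" by simp
  \<comment> \<open>The two \<open>Lee_field\<close> terms cancel by symmetry of the metric.\<close>
  also have "\<dots> = lincomb (omega p (Y p)) (X p) (- omega p (X p)) (Y p)"
    using g_sym[OF t] by (simp add: torsion_def nabla_c_def X Y t lincomb_def fun_eq_iff)
  finally show "g p (torsion A nabla_c X Y p) z =
      (- 1) * omega p (X p) * g p (Y p) z - (- 1) * omega p (Y p) * g p (X p) z"
    using z t by (simp add: g_lincomb_left)
qed

section \<open>Compatibility with the structure\<close>

lemma nabla_c_xi: "v \<in> tangent A p \<Longrightarrow> nabla_c p v \<xi> = (\<lambda>_. 0)"
  by (rule g_nondegenerate[where p = p])
    (simp_all add: nabla_c_tangent xi_near tangent_zero g_nabla_c Dg_xi g_zero eta_eq g_sym[OF _ xi_tangent])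

lemma g_nabla_c_lincomb:
  "v \<in> tangent A p \<Longrightarrow> w \<in> tangent A p \<Longrightarrow> vfield_near A p Y \<Longrightarrow> z \<in> tangent A p \<Longrightarrow>
    g p (nabla_c p (lincomb a v b w) Y) z = a * g p (nabla_c p v Y) z + b * g p (nabla_c p w Y) z"
  by (simp add: connection_lincomb[OF connection_nabla_c] g_lincomb_left nabla_c_tangent)

text \<open>In an adapted frame \<open>\<phi>\<close> has the constant matrix \<open>Phi0\<close>
  and, by \<open>comp\<close>, the connection has coefficients in u(2). The claim on frame vectors
  is therefore \<open>u2_forms_commute\<close>.\<close>

lemma nabla_c_phi_frame:
  assumes e: "adapted_frame_on A g \<xi> \<phi> U e" and p: "p \<in> U"
    and a: "\<And>i. frame_torsion e p $ i - theta0 a $ i \<in> u2_forms"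
    and v: "v \<in> tangent A p"
  shows "nabla_c p v (\<lambda>q. \<phi> q (e k q)) = \<phi> p (nabla_c p v (e k))"
proof -
  note t = frame_tangent[OF e p] and b = frame_orthonormal[OF e p] and n = frame_near[OF e p]
  note Lee = frame_Lee[OF e p a]
  have comp: "g p (nabla_c p (e i p) (e j)) (e k p) = (frame_torsion e p $ i - theta0 a $ i) $ j $ k" for i j k
    using Lee(2) omega_Lee[OF Lee(1)] t
    by (simp add: g_nabla_c n frame_torsion_def theta0_def mat_def frame_g[OF e p])
  have phi_e: "\<phi> q (e k q) = (\<lambda>f. \<Sum>l\<in>UNIV. Phi0 $ l $ k * e l q f)" if "q \<in> U" for q k
    using orthonormal_expansion[OF frame_orthonormal[OF e that] phi_tangent[OF frame_tangent[OF e that]], of k]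
    by (simp add: frame_Phi[OF e that])
  have 1: "g p (nabla_c p v (\<lambda>q. \<phi> q (e k q))) z = (\<Sum>l\<in>UNIV. Phi0 $ l $ k * g p (nabla_c p v (e l)) z)"
    if v: "v \<in> tangent A p" and z: "z \<in> tangent A p" for v z
  proof -
    have "nabla_c p v (\<lambda>q. \<phi> q (e k q)) = nabla_c p v (\<lambda>q f. \<Sum>l\<in>UNIV. Phi0 $ l $ k * e l q f)"
      by (rule connection_cong[OF connection_nabla_c v phi_near[OF n] frame_open[OF e] p phi_e])
    also have "\<dots> = (\<lambda>f. \<Sum>l\<in>UNIV. Phi0 $ l $ k * nabla_c p v (e l) f)"
      by (rule connection_sum[OF connection_nabla_c v]) (simp_all add: n)
    finally show ?thesis
      using linear_tangent_sum[where p = p and L = "\<lambda>w. g p w z" and I = UNIV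
          and b = "\<lambda>l. nabla_c p v (e l)" and c = "\<lambda>l. Phi0 $ l $ k"]
      by (simp add: g_lincomb_left z nabla_c_tangent v n)
  qed
  have 2: "g p (\<phi> p (nabla_c p v (e k))) (e m p) =
      - (\<Sum>l\<in>UNIV. Phi0 $ l $ m * g p (nabla_c p v (e k)) (e l p))" if v: "v \<in> tangent A p" for v m
    using phi_skew[OF nabla_c_tangent[OF v n] t] linear_tangent_sum[where p = p and
        L = "\<lambda>w. g p (nabla_c p v (e k)) w" and I = UNIV and b = "\<lambda>l. e l p" and c = "\<lambda>l. Phi0 $ l $ m"]
    by (simp add: phi_e[OF p] g_lincomb_right nabla_c_tangent v n t)
  have Phi0_skew: "- (Phi0 $ l $ m) = Phi0 $ m $ l" for l m
    by (simp add: Phi0_def wedge11_def)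
  have 3: "g p (nabla_c p (e i p) (\<lambda>q. \<phi> q (e k q))) (e m p) = g p (\<phi> p (nabla_c p (e i p) (e k))) (e m p)" for i m
  proof -
    have "- (\<Sum>l\<in>UNIV. Phi0 $ l $ m * x l) = (\<Sum>l\<in>UNIV. x l * Phi0 $ m $ l)" for x
      unfolding sum_negf[symmetric] by (intro sum.cong refl) (simp add: Phi0_skew[of _ m, symmetric])
    then show ?thesis unfolding 1[OF t t] 2[OF t] comp using u2_forms_commute[OF a[of i], of k m] by simp
  qed
  have 4: "g p (nabla_c p v (\<lambda>q. \<phi> q (e k q))) (e m p) = g p (\<phi> p (nabla_c p v (e k))) (e m p)" for m
    by (rule linear_eq_on_basis[OF b v, where L = "\<lambda>v. g p (nabla_c p v (\<lambda>q. \<phi> q (e k q))) (e m p)"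
          and M = "\<lambda>v. g p (\<phi> p (nabla_c p v (e k))) (e m p)"])
      (simp_all add: 3 g_nabla_c_lincomb phi_near n t connection_lincomb[OF connection_nabla_c]
        phi_lincomb nabla_c_tangent phi_tangent g_lincomb_left)
  have tt: "nabla_c p v (\<lambda>q. \<phi> q (e k q)) \<in> tangent A p" "\<phi> p (nabla_c p v (e k)) \<in> tangent A p"
    by (simp_all add: nabla_c_tangent phi_tangent phi_near n v)
  show ?thesis
  proof (rule g_nondegenerate[OF tt])
    fix z assume z: "z \<in> tangent A p"
    show "g p (nabla_c p v (\<lambda>q. \<phi> q (e k q))) z = g p (\<phi> p (nabla_c p v (e k))) z"
      by (rule linear_eq_on_basis[OF b z, where L = "g p (nabla_c p v (\<lambda>q. \<phi> q (e k q)))"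
          and M = "g p (\<phi> p (nabla_c p v (e k)))"]) (simp_all add: 4 g_lincomb_right tt)
  qed
qed

text \<open>Instead of expanding \<open>Y\<close> with variable coefficients, differentiate the
  skewness relation between \<open>g q (\<phi> q (Y q)) (e k q)\<close> and
  \<open>g q (Y q) (\<phi> q (e k q))\<close>. The frame case handles \<open>\<phi>\<close> on
  \<open>e k\<close>, and skewness of \<open>\<phi>\<close> cancels the terms differentiating
  \<open>e k\<close>.\<close>

lemma nabla_c_phi:
  assumes v: "v \<in> tangent A p" and Y: "vfield_near A p Y"
  shows "nabla_c p v (\<lambda>q. \<phi> q (Y q)) = \<phi> p (nabla_c p v Y)"
proof -
  obtain U e a where p: "p \<in> U" and e: "adapted_frame_on A g \<xi> \<phi> U e"
    and a: "\<And>i. frame_torsion e p $ i - theta0 a $ i \<in> u2_forms" by (rule class_frame[of p]) (rule that)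
  note t = frame_tangent[OF e p] and n = frame_near[OF e p] and tY = vfield_near_tangent[OF Y]
  note nt = nabla_c_tangent[OF v]
  have tt: "nabla_c p v (\<lambda>q. \<phi> q (Y q)) \<in> tangent A p" "\<phi> p (nabla_c p v Y) \<in> tangent A p"
    using nt Y by (simp_all add: phi_tangent phi_near)
  have *: "g p (nabla_c p v (\<lambda>q. \<phi> q (Y q))) (e k p) = g p (\<phi> p (nabla_c p v Y)) (e k p)" for k
  proof -
    obtain W where W: "p \<in> W" "vfield_on A W Y" using Y by (auto simp: vfield_near_def)
    have o: "open (U \<inter> W)" using W frame_open[OF e] by (auto simp: vfield_on_def)
    have "v (\<lambda>q. g q (\<phi> q (Y q)) (e k q)) = v (\<lambda>q. - g q (Y q) (\<phi> q (e k q)))"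
      by (rule tangent_cong[OF v o]) (use p W frame_tangent[OF e] in \<open>auto simp: vfield_on_def phi_skew\<close>)
    also have "\<dots> = - v (\<lambda>q. g q (Y q) (\<phi> q (e k q)))" by (rule tangent_uminus[OF v])
    finally have "g p (nabla_c p v (\<lambda>q. \<phi> q (Y q))) (e k p) + g p (\<phi> p (Y p)) (nabla_c p v (e k)) =
        - (g p (nabla_c p v Y) (\<phi> p (e k p)) + g p (Y p) (\<phi> p (nabla_c p v (e k))))"
      using metric_rule[OF metric_nabla_c phi_near[OF Y] n v] metric_rule[OF metric_nabla_c Y phi_near[OF n] v]
      by (simp add: nabla_c_phi_frame[OF e p a v])
    then show ?thesis
      using phi_skew[OF tY nt[OF n]] phi_skew[OF nt[OF Y] t] by simp
  qed
  show ?thesis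
  proof (rule g_nondegenerate[OF tt])
    fix z assume z: "z \<in> tangent A p"
    show "g p (nabla_c p v (\<lambda>q. \<phi> q (Y q))) z = g p (\<phi> p (nabla_c p v Y)) z"
      by (rule linear_eq_on_basis[OF frame_orthonormal[OF e p] z,
            where L = "g p (nabla_c p v (\<lambda>q. \<phi> q (Y q)))" and M = "g p (\<phi> p (nabla_c p v Y))"])
        (simp_all add: * g_lincomb_right tt)
  qed
qed

lemma compatible_nabla_c: "compatible A \<xi> \<eta> \<phi> nabla_c"
  unfolding compatible_def
  by (simp add: nabla_c_xi nabla_eta[OF metric_nabla_c] g_zero nabla_c_phi)

text \<open>On admissible arguments both connections obey the formula of
  \<open>compatible_vectorial\<close>; elsewhere both take the default value.\<close>

lemma unique_connection:
  assumes "metric_connection A g D" "vectorial_torsion A g D" "compatible A \<xi> \<eta> \<phi> D"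
  shows "D = nabla_c"
proof (intro ext)
  fix p v Y f
  have "D p v Y = nabla_c p v Y"
  proof (cases "v \<in> tangent A p \<and> vfield_near A p Y")
    case True
    then have v: "v \<in> tangent A p" and Y: "vfield_near A p Y" by auto
    show ?thesis
    proof (rule g_nondegenerate[OF connection_tangent[OF metric_connectionD[OF assms(1)] v Y] nabla_c_tangent[OF v Y]])
      fix z assume z: "z \<in> tangent A p"
      show "g p (D p v Y) z = g p (nabla_c p v Y) z"
        using compatible_vectorial[OF assms v Y z]
          compatible_vectorial[OF metric_nabla_c vectorial_nabla_c compatible_nabla_c v Y z] by simp
    qed
  qed (simp only: connection_undefined[OF metric_connectionD[OF assms(1)]]
      connection_undefined[OF connection_nabla_c] not_False_eq_True)
  then show "D p v Y f = nabla_c p v Y f" by simp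
qed

end
end
theorem theorem4p1:
  fixes A :: "'m::{t2_space, second_countable_topology} chart set"
    and g :: "'m metric" and \<xi> :: "'m vfield" and \<eta> :: "'m oneform" and \<phi> :: "'m endo"
    and Dg :: "'m conn"
  assumes acm: "almost_contact_metric A g \<xi> \<eta> \<phi>"
    and lc: "levi_civita A g Dg"
    and cls: "of_class A g \<xi> \<phi> Dg W1_plus_W2"
  shows "(\<exists>!Dc. metric_connection A g Dc \<and> vectorial_torsion A g Dc \<and> compatible A \<xi> \<eta> \<phi> Dc) \<and>
    (\<forall>Dc. metric_connection A g Dc \<and> vectorial_torsion A g Dc \<and> compatible A \<xi> \<eta> \<phi> Dc \<longrightarrow>
      (\<forall>p Y. vfield_near A p Y \<longrightarrow> (\<forall>x\<in>tangent A p. \<forall>z\<in>tangent A p.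
        g p (Dc p x Y) z = g p (Dg p x Y) z
          - theta1 g (\<lambda>q v. 1/4 * codiff A g Dg \<eta> q * \<eta> q v + ext_deriv A g Dg \<eta> q (\<xi> q) v)
              p x (Y p) z))) \<and>
    (of_class A g \<xi> \<phi> Dg W1 \<longleftrightarrow>
      (\<forall>p. \<forall>v\<in>tangent A p. \<forall>w\<in>tangent A p. ext_deriv A g Dg \<eta> p v w = 0)) \<and>
    (of_class A g \<xi> \<phi> Dg W2 \<longleftrightarrow> (\<forall>p. codiff A g Dg \<eta> p = 0))"
proof -
  have "smooth_manifold A"
    using acm by (simp add: smooth_manifold_def almost_contact_metric_def)
  moreover have "riemannian_metric A g"
    using acm by (simp add: almost_contact_metric_def)
  \<comment> \<open>The adapted frames demanded by the locale are read off from the class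
    hypothesis.\<close>
  moreover have "\<exists>U e. p \<in> U \<and> adapted_frame_on A g \<xi> \<phi> U e" for p
    using cls unfolding of_class_def by blast
  ultimately interpret framed_acm_manifold A g \<xi> \<eta> \<phi> Dg
    using acm lc by (simp add: framed_acm_manifold_def framed_acm_manifold_axioms_def
        riemannian_manifold_def riemannian_manifold_axioms_def)
  show ?thesis
  proof (intro conjI)
    show "\<exists>!Dc. metric_connection A g Dc \<and> vectorial_torsion A g Dc \<and> compatible A \<xi> \<eta> \<phi> Dc"
      using metric_nabla_c[OF cls] vectorial_nabla_c[OF cls] compatible_nabla_c[OF cls]
        unique_connection[OF cls] by blast
    show "\<forall>Dc. metric_connection A g Dc \<and> vectorial_torsion A g Dc \<and> compatible A \<xi> \<eta> \<phi> Dc \<longrightarrow>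
      (\<forall>p Y. vfield_near A p Y \<longrightarrow> (\<forall>x\<in>tangent A p. \<forall>z\<in>tangent A p.
        g p (Dc p x Y) z = g p (Dg p x Y) z
          - theta1 g (\<lambda>q v. 1/4 * codiff A g Dg \<eta> q * \<eta> q v + ext_deriv A g Dg \<eta> q (\<xi> q) v)
              p x (Y p) z))"
      using compatible_vectorial unfolding omega_def[abs_def] by blast
  qed (rule of_class_W1_iff[OF cls] of_class_W2_iff[OF cls])+
qed

end
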